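(* Let $(A,\sigma)$ be an Azumaya algebra with involution of the first kind over $K$. Then in $SW(K)$ (isometry classes of nondegenerate symmetric bilinear forms over $K$): $$\lambda^2(\langle1\rangle_\sigma)=\langle2\rangle T_\sigma^{-\varepsilon(\sigma)}.$$
   Context: $K$ is a field of characteristic $\ne2$; an Azumaya algebra with involution of the first kind over $K$ is an Azumaya $K$-algebra $A$ with a $K$-linear involution $\sigma$; $\varepsilon(\sigma)=1$ if $\sigma$ is orthogonal, $-1$ if symplectic. $\otimes=\otimes_K$. $\langle1\rangle_\sigma$ is the hermitian form $(x,y)\mapsto\sigma(x)y$ on the right $A$-module $A$. $\langle 2\rangle b$ is the form $2\cdot b$. $T_\sigma(x,y)=\mathrm{Trd}_A(\sigma(x)y)$ is the involution trace form on $A$; $T_\sigma^{+}=T_\sigma^{1}$ (resp. $T_\sigma^-=T_\sigma^{-1}$) is its restriction to the subspace $\{x\in A:\sigma(x)=x\}$ (resp. $\{x\in A:\sigma(x)=-x\}$). The Goldman element $g_A=\sum a_i\otimes b_i\in A\otimes A$ is characterized by $\sum a_ixb_i=\mathrm{Trd}_A(x)$ for all $x\in A$. Put $s_2=1-g_A\in A\otimes A$ and $\mathrm{Alt}^2(A)=s_2(A\otimes A)$, a right $A\otimes A$-module, with hermitian form over $(A\otimes A,\sigma\otimes\sigma)$ given by $\mathrm{Alt}^2(\langle1\rangle_\sigma)(s_2x,s_2y)=(\sigma\otimes\sigma)(s_2x)\,y$. $|A|_\sigma$ is the left $A\otimes A$-module $A$ with action $(a\otimes b)\cdot x=ax\sigma(b)$.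 $\lambda^2(\langle1\rangle_\sigma)\in SW(K)$ is the isometry class of the symmetric bilinear space $\mathrm{Alt}^2(A)\otimes_{A\otimes A}|A|_\sigma$ with form $(u\otimes v,u'\otimes v')\mapsto T_\sigma(v,\mathrm{Alt}^2(\langle1\rangle_\sigma)(u,u')\cdot v')$. *)

theory Defs
  imports
    "HOL-Algebra.Algebraic_Closure_Type"
    "HOL-Computational_Algebra.Group_Closure"
    "HOL-Library.Poly_Mapping"
    "HOL-Library.Set_Algebras"
    "Jordan_Normal_Form.Matrix"
begin

section \<open>Tensor products\<close>

text \<open>
  The tensor product of a right \<open>R\<close>-module \<open>M\<close> and a left \<open>R\<close>-module \<open>N\<close> is the free abelian
  group on \<open>M \<times> N\<close> modulo the usual relations.  Its elements are cosets, so the sum of two of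
  them is their sum \<open>U + W\<close> as sets, and its zero is the subgroup of relations itself.
  (On sets, \<open>-\<close> is complement resp. set difference; the opposite of a coset \<open>U\<close> is
  \<open>uminus ` U\<close>.)
\<close>

definition tensor_ker ::
  "'m::plus set \<Rightarrow> 'r set \<Rightarrow> ('m \<Rightarrow> 'r \<Rightarrow> 'm) \<Rightarrow> 'n::plus set \<Rightarrow> ('r \<Rightarrow> 'n \<Rightarrow> 'n) \<Rightarrow>
    ('m \<times> 'n \<Rightarrow>\<^sub>0 int) set" where
  "tensor_ker M R ract N lact = group_closure
    ({frag_of (x + x', y) - frag_of (x, y) - frag_of (x', y) | x x' y. x \<in> M \<and> x' \<in> M \<and> y \<in> N} \<union>
     {frag_of (x, y + y') - frag_of (x, y) - frag_of (x, y') | x y y'. x \<in> M \<and> y \<in> N \<and> y' \<in> N} \<union>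
     {frag_of (ract x r, y) - frag_of (x, lact r y) | x r y. x \<in> M \<and> r \<in> R \<and> y \<in> N})"

definition tensor_carrier ::
  "'m::plus set \<Rightarrow> 'r set \<Rightarrow> ('m \<Rightarrow> 'r \<Rightarrow> 'm) \<Rightarrow> 'n::plus set \<Rightarrow> ('r \<Rightarrow> 'n \<Rightarrow> 'n) \<Rightarrow>
    ('m \<times> 'n \<Rightarrow>\<^sub>0 int) set set" where
  "tensor_carrier M R ract N lact =
    {f +o tensor_ker M R ract N lact | f. Poly_Mapping.keys f \<subseteq> M \<times> N}"

text \<open>
  The additive map on a tensor product with \<open>m \<otimes> n \<mapsto> h (m, n)\<close>; meaningful when \<open>h\<close> is
  biadditive and balanced.
\<close>

definition tensor_lift :: "('b \<Rightarrow> 'c::ring_1) \<Rightarrow> ('b \<Rightarrow>\<^sub>0 int) set \<Rightarrow> 'c" where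
  "tensor_lift h U =
    the_elem ((\<lambda>f. \<Sum>p\<in>Poly_Mapping.keys f. of_int (Poly_Mapping.lookup f p) * h p) ` U)"

text \<open>Tensor products over a field \<open>'k\<close> of two vector spaces given by their scalar multiplications.\<close>

definition vtensor_ker ::
  "('k \<Rightarrow> 'a::plus \<Rightarrow> 'a) \<Rightarrow> ('k \<Rightarrow> 'b::plus \<Rightarrow> 'b) \<Rightarrow> ('a \<times> 'b \<Rightarrow>\<^sub>0 int) set" where
  "vtensor_ker sA sB = tensor_ker UNIV UNIV (\<lambda>a k. sA k a) UNIV sB"

definition vtensor ::
  "('k \<Rightarrow> 'a::plus \<Rightarrow> 'a) \<Rightarrow> ('k \<Rightarrow> 'b::plus \<Rightarrow> 'b) \<Rightarrow> ('a \<times> 'b \<Rightarrow>\<^sub>0 int) set set" where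
  "vtensor sA sB = tensor_carrier UNIV UNIV (\<lambda>a k. sA k a) UNIV sB"


section \<open>Azumaya algebras with involution of the first kind\<close>

definition k_algebra :: "('k::field \<Rightarrow> 'a::ring_1 \<Rightarrow> 'a) \<Rightarrow> bool" where
  "k_algebra s \<longleftrightarrow> vector_space s \<and>
    (\<forall>k a b. s k (a * b) = s k a * b) \<and> (\<forall>k a b. s k (a * b) = a * s k b)"

text \<open>The map \<open>\<Sum> a\<^sub>i \<otimes> b\<^sub>i \<mapsto> (x \<mapsto> \<Sum> a\<^sub>i x b\<^sub>i)\<close>.\<close>

definition sandwich :: "('a::ring_1 \<times> 'a \<Rightarrow>\<^sub>0 int) set \<Rightarrow> 'a \<Rightarrow> 'a" where
  "sandwich z x = tensor_lift (\<lambda>(a, b). a * x * b) z"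

text \<open>
  \<open>A\<close> is Azumaya over \<open>K\<close> if it is a faithful finitely generated projective \<open>K\<close>-module and
  the canonical map from \<open>A \<otimes> A\<^sup>o\<^sup>p\<close> to \<open>End\<^sub>K(A)\<close> is bijective.  Over a field the first
  condition says that \<open>A\<close> is nonzero (which holds for every type of class \<open>ring_1\<close>) and
  finite-dimensional.
\<close>

definition azumaya_algebra :: "('k::field \<Rightarrow> 'a::ring_1 \<Rightarrow> 'a) \<Rightarrow> bool" where
  "azumaya_algebra s \<longleftrightarrow> k_algebra s \<and>
    (\<exists>B. finite B \<and> Modules.module.span s B = UNIV) \<and>
    bij_betw sandwich (vtensor s s) {f. Vector_Spaces.linear s s f}"

definition involution_first_kind :: "('k::field \<Rightarrow> 'a::ring_1 \<Rightarrow> 'a) \<Rightarrow> ('a \<Rightarrow> 'a) \<Rightarrow> bool" where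
  "involution_first_kind s \<sigma> \<longleftrightarrow> Vector_Spaces.linear s s \<sigma> \<and>
    (\<forall>x y. \<sigma> (x * y) = \<sigma> y * \<sigma> x) \<and> (\<forall>x. \<sigma> (\<sigma> x) = x)"


section \<open>Reduced trace and type of an involution\<close>

text \<open>
  Let \<open>L\<close> be the algebraic closure of \<open>K\<close>.  An isomorphism of \<open>L\<close>-algebras
  \<open>A \<otimes> L \<cong> M\<^sub>n(L)\<close> is given by its restriction \<open>\<phi>\<close> to \<open>A\<close>: a homomorphism of
  \<open>K\<close>-algebras whose \<open>L\<close>-linear extension \<open>a \<otimes> l \<mapsto> l \<phi>(a)\<close> (written entrywise below)
  is bijective.
\<close>

definition splitting ::
  "('k::field \<Rightarrow> 'a::ring_1 \<Rightarrow> 'a) \<Rightarrow> nat \<Rightarrow> ('a \<Rightarrow> 'k alg_closure mat) \<Rightarrow> bool" where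
  "splitting s n \<phi> \<longleftrightarrow>
    (\<forall>x. \<phi> x \<in> carrier_mat n n) \<and>
    \<phi> 1 = 1\<^sub>m n \<and>
    (\<forall>x y. \<phi> (x * y) = \<phi> x * \<phi> y) \<and>
    (\<forall>x y. \<phi> (x + y) = \<phi> x + \<phi> y) \<and>
    (\<forall>k x. \<phi> (s k x) = to_ac k \<cdot>\<^sub>m \<phi> x) \<and>
    bij_betw (\<lambda>z. mat n n (\<lambda>(i, j). tensor_lift (\<lambda>(a, l). l * \<phi> a $$ (i, j)) z))
      (vtensor s (\<lambda>k l. to_ac k * l)) (carrier_mat n n)"

text \<open>The value does not depend on the splitting, and lies in \<open>K\<close>.\<close>

definition Trd :: "('k::field \<Rightarrow> 'a::ring_1 \<Rightarrow> 'a) \<Rightarrow> 'a \<Rightarrow> 'k" where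
  "Trd s x = (THE c. \<exists>n \<phi>. splitting s n \<phi> \<and> to_ac c = (\<Sum>i<n. \<phi> x $$ (i, i)))"

text \<open>
  After a splitting, \<open>\<sigma>\<close> is adjoint to the nondegenerate bilinear form
  \<open>(u, v) \<mapsto> u\<^sup>T G v\<close> on \<open>L\<^sup>n\<close>.  As both sides are \<open>L\<close>-linear, it is enough to
  state the adjunction on \<open>A\<close>.
\<close>

definition adjoint_to ::
  "('k::field \<Rightarrow> 'a::ring_1 \<Rightarrow> 'a) \<Rightarrow> ('a \<Rightarrow> 'a) \<Rightarrow> nat \<Rightarrow> ('a \<Rightarrow> 'k alg_closure mat) \<Rightarrow>
    'k alg_closure mat \<Rightarrow> bool" where
  "adjoint_to s \<sigma> n \<phi> G \<longleftrightarrow> splitting s n \<phi> \<and> G \<in> carrier_mat n n \<and> invertible_mat G \<and>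
    (\<forall>x. transpose_mat (\<phi> x) * G = G * \<phi> (\<sigma> x))"

definition orthogonal_involution :: "('k::field \<Rightarrow> 'a::ring_1 \<Rightarrow> 'a) \<Rightarrow> ('a \<Rightarrow> 'a) \<Rightarrow> bool" where
  "orthogonal_involution s \<sigma> \<longleftrightarrow>
    (\<exists>n \<phi> G. adjoint_to s \<sigma> n \<phi> G \<and> transpose_mat G = G)"

definition symplectic_involution :: "('k::field \<Rightarrow> 'a::ring_1 \<Rightarrow> 'a) \<Rightarrow> ('a \<Rightarrow> 'a) \<Rightarrow> bool" where
  "symplectic_involution s \<sigma> \<longleftrightarrow>
    (\<exists>n \<phi> G. adjoint_to s \<sigma> n \<phi> G \<and> transpose_mat G = - G \<and> (\<forall>i<n. G $$ (i, i) = 0))"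

definition involution_sign :: "('k::field \<Rightarrow> 'a::ring_1 \<Rightarrow> 'a) \<Rightarrow> ('a \<Rightarrow> 'a) \<Rightarrow> int" where
  "involution_sign s \<sigma> = (THE e. (orthogonal_involution s \<sigma> \<and> e = 1) \<or>
    (symplectic_involution s \<sigma> \<and> e = -1))"


section \<open>Symmetric bilinear spaces\<close>

text \<open>The fields \<open>mult\<close> and \<open>one\<close> of the underlying module record are irrelevant.\<close>

record ('k, 'v) bilinear_space = "('k, 'v) module" +
  form :: "'v \<Rightarrow> 'v \<Rightarrow> 'k"

definition nondeg_symmetric_space :: "('k::field, 'v) bilinear_space \<Rightarrow> bool" where
  "nondeg_symmetric_space V \<longleftrightarrow>
    Module.module (ring_of_type_algebra :: 'k ring) V \<and>
    (\<exists>B. finite B \<and> B \<subseteq> carrier V \<and>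
      (\<forall>H. submodule H (ring_of_type_algebra :: 'k ring) V \<and> B \<subseteq> H \<longrightarrow> H = carrier V)) \<and>
    (\<forall>x\<in>carrier V. \<forall>y\<in>carrier V. \<forall>z\<in>carrier V.
      form V (x \<oplus>\<^bsub>V\<^esub> y) z = form V x z + form V y z) \<and>
    (\<forall>k. \<forall>x\<in>carrier V. \<forall>y\<in>carrier V. form V (k \<odot>\<^bsub>V\<^esub> x) y = k * form V x y) \<and>
    (\<forall>x\<in>carrier V. \<forall>y\<in>carrier V. form V x y = form V y x) \<and>
    (\<forall>x\<in>carrier V. (\<forall>y\<in>carrier V. form V x y = 0) \<longrightarrow> x = \<zero>\<^bsub>V\<^esub>)"

definition isometric ::
  "('k::field, 'v) bilinear_space \<Rightarrow> ('k, 'w) bilinear_space \<Rightarrow> bool" where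
  "isometric V W \<longleftrightarrow> (\<exists>f. bij_betw f (carrier V) (carrier W) \<and>
    (\<forall>x\<in>carrier V. \<forall>y\<in>carrier V. f (x \<oplus>\<^bsub>V\<^esub> y) = f x \<oplus>\<^bsub>W\<^esub> f y) \<and>
    (\<forall>k. \<forall>x\<in>carrier V. f (k \<odot>\<^bsub>V\<^esub> x) = k \<odot>\<^bsub>W\<^esub> f x) \<and>
    (\<forall>x\<in>carrier V. \<forall>y\<in>carrier V. form W (f x) (f y) = form V x y))"

text \<open>\<open>V\<close> and \<open>W\<close> define elements of \<open>SW(K)\<close>, and these are equal.\<close>

definition SW_eq :: "('k::field, 'v) bilinear_space \<Rightarrow> ('k, 'w) bilinear_space \<Rightarrow> bool" where
  "SW_eq V W \<longleftrightarrow> nondeg_symmetric_space V \<and> nondeg_symmetric_space W \<and> isometric V W"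

definition scale_form :: "'k::field \<Rightarrow> ('k, 'v) bilinear_space \<Rightarrow> ('k, 'v) bilinear_space" where
  "scale_form c V = V\<lparr>form := \<lambda>x y. c * form V x y\<rparr>"


section \<open>Involution trace forms\<close>

definition trace_form ::
  "('k::field \<Rightarrow> 'a::ring_1 \<Rightarrow> 'a) \<Rightarrow> ('a \<Rightarrow> 'a) \<Rightarrow> 'a \<Rightarrow> 'a \<Rightarrow> 'k" where
  "trace_form s \<sigma> x y = Trd s (\<sigma> x * y)"

text \<open>\<open>T\<^sub>\<sigma>\<^sup>\<epsilon>\<close>, used for \<open>\<epsilon> \<in> {1, -1}\<close>.\<close>

definition trace_form_part ::
  "('k::field \<Rightarrow> 'a::ring_1 \<Rightarrow> 'a) \<Rightarrow> ('a \<Rightarrow> 'a) \<Rightarrow> int \<Rightarrow> ('k, 'a) bilinear_space" where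
  "trace_form_part s \<sigma> e =
    \<lparr>carrier = {x. \<sigma> x = of_int e * x}, monoid.mult = undefined, one = undefined,
     ring.zero = 0, add = (+), module.smult = s, form = trace_form s \<sigma>\<rparr>"


section \<open>The exterior square of the rank one hermitian form\<close>

definition aa_mult :: "('k::field \<Rightarrow> 'a::ring_1 \<Rightarrow> 'a) \<Rightarrow>
    ('a \<times> 'a \<Rightarrow>\<^sub>0 int) set \<Rightarrow> ('a \<times> 'a \<Rightarrow>\<^sub>0 int) set \<Rightarrow> ('a \<times> 'a \<Rightarrow>\<^sub>0 int) set" where
  "aa_mult s U W = (\<Union>x\<in>U. \<Union>y\<in>W.
    frag_extend (\<lambda>(a, b). frag_extend (\<lambda>(c, d). frag_of (a * c, b * d)) y) x +o vtensor_ker s s)"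

definition aa_one :: "('k::field \<Rightarrow> 'a::ring_1 \<Rightarrow> 'a) \<Rightarrow> ('a \<times> 'a \<Rightarrow>\<^sub>0 int) set" where
  "aa_one s = frag_of (1, 1) +o vtensor_ker s s"

text \<open>The involution \<open>\<sigma> \<otimes> \<sigma>\<close> of \<open>A \<otimes> A\<close>.\<close>

definition aa_inv :: "('k::field \<Rightarrow> 'a::ring_1 \<Rightarrow> 'a) \<Rightarrow> ('a \<Rightarrow> 'a) \<Rightarrow>
    ('a \<times> 'a \<Rightarrow>\<^sub>0 int) set \<Rightarrow> ('a \<times> 'a \<Rightarrow>\<^sub>0 int) set" where
  "aa_inv s \<sigma> U = (\<Union>x\<in>U. frag_extend (\<lambda>(a, b). frag_of (\<sigma> a, \<sigma> b)) x +o vtensor_ker s s)"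

definition goldman :: "('k::field \<Rightarrow> 'a::ring_1 \<Rightarrow> 'a) \<Rightarrow> ('a \<times> 'a \<Rightarrow>\<^sub>0 int) set" where
  "goldman s = (THE g. g \<in> vtensor s s \<and> (\<forall>x. sandwich g x = s (Trd s x) 1))"

definition s2 :: "('k::field \<Rightarrow> 'a::ring_1 \<Rightarrow> 'a) \<Rightarrow> ('a \<times> 'a \<Rightarrow>\<^sub>0 int) set" where
  "s2 s = aa_one s + uminus ` goldman s"

definition Alt2 :: "('k::field \<Rightarrow> 'a::ring_1 \<Rightarrow> 'a) \<Rightarrow> ('a \<times> 'a \<Rightarrow>\<^sub>0 int) set set" where
  "Alt2 s = aa_mult s (s2 s) ` vtensor s s"

text \<open>\<open>(u, s\<^sub>2 y) \<mapsto> (\<sigma> \<otimes> \<sigma>)(u) y\<close>\<close>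

definition Alt2_form :: "('k::field \<Rightarrow> 'a::ring_1 \<Rightarrow> 'a) \<Rightarrow> ('a \<Rightarrow> 'a) \<Rightarrow>
    ('a \<times> 'a \<Rightarrow>\<^sub>0 int) set \<Rightarrow> ('a \<times> 'a \<Rightarrow>\<^sub>0 int) set \<Rightarrow> ('a \<times> 'a \<Rightarrow>\<^sub>0 int) set" where
  "Alt2_form s \<sigma> u u' =
    (THE z. \<exists>y\<in>vtensor s s. u' = aa_mult s (s2 s) y \<and> z = aa_mult s (aa_inv s \<sigma> u) y)"

text \<open>The action of \<open>A \<otimes> A\<close> on \<open>|A|\<^sub>\<sigma>\<close>.\<close>

definition twisted_action :: "('a::ring_1 \<Rightarrow> 'a) \<Rightarrow> ('a \<times> 'a \<Rightarrow>\<^sub>0 int) set \<Rightarrow> 'a \<Rightarrow> 'a" where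
  "twisted_action \<sigma> z x = tensor_lift (\<lambda>(a, b). a * x * \<sigma> b) z"

definition lambda2_ker :: "('k::field \<Rightarrow> 'a::ring_1 \<Rightarrow> 'a) \<Rightarrow> ('a \<Rightarrow> 'a) \<Rightarrow>
    (('a \<times> 'a \<Rightarrow>\<^sub>0 int) set \<times> 'a \<Rightarrow>\<^sub>0 int) set" where
  "lambda2_ker s \<sigma> = tensor_ker (Alt2 s) (vtensor s s) (aa_mult s) UNIV (twisted_action \<sigma>)"

definition lambda2 :: "('k::field \<Rightarrow> 'a::ring_1 \<Rightarrow> 'a) \<Rightarrow> ('a \<Rightarrow> 'a) \<Rightarrow>
    ('k, (('a \<times> 'a \<Rightarrow>\<^sub>0 int) set \<times> 'a \<Rightarrow>\<^sub>0 int) set) bilinear_space" where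
  "lambda2 s \<sigma> =
    \<lparr>carrier = tensor_carrier (Alt2 s) (vtensor s s) (aa_mult s) UNIV (twisted_action \<sigma>),
     monoid.mult = undefined, one = undefined,
     ring.zero = lambda2_ker s \<sigma>, add = (+),
     module.smult = (\<lambda>k U. \<Union>x\<in>U. frag_extend (\<lambda>(u, v). frag_of (u, s k v)) x +o lambda2_ker s \<sigma>),
     form = (\<lambda>U W. tensor_lift (\<lambda>(u, v). tensor_lift (\<lambda>(u', v').
       trace_form s \<sigma> v (twisted_action \<sigma> (Alt2_form s \<sigma> u u') v')) W) U)\<rparr>"

end

theory Submission
  imports Defs "Jordan_Normal_Form.Char_Poly"
begin

text \<open>
  Letting \<open>a \<otimes> b\<close> act on \<open>A\<close> by \<open>v \<mapsto> a v \<sigma>(b)\<close> identifies \<open>A \<otimes> A\<close> with \<open>End\<^sub>K(A)\<close>, so that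
  \<open>\<sigma>\<close> itself is the action of a tensor \<open>\<gamma> = \<Sum> a\<^sub>i \<otimes> b\<^sub>i\<close>.  Since \<open>\<sigma>\<close> is an anti-automorphism,
  \<open>(x \<otimes> y) \<gamma> = \<gamma> (y \<otimes> x)\<close>, so \<open>\<Sum> a\<^sub>i x b\<^sub>i\<close> is central and equals \<open>\<tau>(x) 1\<close> for a linear form
  \<open>\<tau>\<close>; since \<open>\<sigma>\<^sup>2 = id\<close>, also \<open>\<gamma>\<^sup>2 = 1\<close>, which says that \<open>a\<^sub>i\<close> and \<open>b\<^sub>i\<close> are dual with respect to
  \<open>\<tau>\<close>.  By Schur's lemma, \<open>\<gamma>\<close> becomes a multiple \<open>t\<close> of the interchange of tensor factors in every
  irreducible representation over the algebraic closure.  This yields Burnside's theorem (the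
  representation is a splitting), the Skolem--Noether theorem and \<open>\<tau> = t Trd\<close>, while a form \<open>G\<close> to
  which \<open>\<sigma>\<close> is adjoint satisfies \<open>G\<^sup>T = t G\<close>.  Hence \<open>t = \<epsilon>(\<sigma>)\<close> and the Goldman element is
  \<open>\<epsilon>(\<sigma>) \<gamma>\<close>, which acts on \<open>|A|\<^sub>\<sigma>\<close> as \<open>\<epsilon>(\<sigma>) \<sigma>\<close>.

  Every element of \<open>Alt\<^sup>2(A) \<otimes> |A|\<^sub>\<sigma>\<close> is of the form \<open>s\<^sub>2 \<otimes> v\<close>, and it vanishes iff
  \<open>s\<^sub>2 v = v - \<epsilon> \<sigma>(v)\<close> does.  The isometry is \<open>s\<^sub>2 \<otimes> v \<mapsto> (v - \<epsilon> \<sigma>(v)) / 2\<close>.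
\<close>


section \<open>Cosets of subgroups of free abelian groups\<close>

locale add_subgroup =
  fixes H :: "'b::ab_group_add set"
  assumes zero_mem: "0 \<in> H"
    and diff_mem: "x \<in> H \<Longrightarrow> y \<in> H \<Longrightarrow> x - y \<in> H"
begin

lemma uminus_mem: "x \<in> H \<Longrightarrow> - x \<in> H"
  using diff_mem[OF zero_mem] by simp

lemma add_mem: "x \<in> H \<Longrightarrow> y \<in> H \<Longrightarrow> x + y \<in> H"
  using diff_mem[OF _ uminus_mem] by simp

lemma sum_mem: "(\<And>i. i \<in> I \<Longrightarrow> f i \<in> H) \<Longrightarrow> (\<Sum>i\<in>I. f i) \<in> H"
  by (induction I rule: infinite_finite_induct) (auto intro: zero_mem add_mem)

lemma mem_coset_self: "f \<in> f +o H"
  using set_plus_intro2[OF zero_mem, of f] by simp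

lemma coset_eq_iff: "f +o H = g +o H \<longleftrightarrow> f - g \<in> H"
proof
  assume "f +o H = g +o H"
  then show "f - g \<in> H" using mem_coset_self set_plus_imp_minus by blast
next
  have coset_subset: "x +o H \<subseteq> y +o H" if "x - y \<in> H" for x y
  proof
    fix z assume "z \<in> x +o H"
    then have "(z - x) + (x - y) \<in> H" using that by (blast intro: add_mem set_plus_imp_minus)
    then show "z \<in> y +o H" by (simp add: set_minus_imp_plus)
  qed
  assume "f - g \<in> H"
  moreover from this have "g - f \<in> H" using uminus_mem by fastforce
  ultimately show "f +o H = g +o H" using coset_subset by blast
qed

lemma coset_plus: "(f +o H) + (g +o H) = (f + g) +o H"
proof -
  have "H + H = H"
  proof
    show "H + H \<subseteq> H" by (auto elim!: set_plus_elim intro: add_mem)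
    show "H \<subseteq> H + H" using zero_mem by (rule set_zero_plus2)
  qed
  then show ?thesis by (simp add: set_plus_rearrange)
qed

lemma coset_uminus: "uminus ` (f +o H) = (- f) +o H"
proof
  have uminus_coset_subset: "uminus ` (g +o H) \<subseteq> (- g) +o H" for g
  proof
    fix x assume "x \<in> uminus ` (g +o H)"
    then obtain y where "y \<in> g +o H" "x = - y" by blast
    then have "x - (- g) \<in> H" using uminus_mem[OF set_plus_imp_minus[of y g H]] by simp
    then show "x \<in> (- g) +o H" by (rule set_minus_imp_plus)
  qed
  show "uminus ` (f +o H) \<subseteq> (- f) +o H" by (rule uminus_coset_subset)
  show "(- f) +o H \<subseteq> uminus ` (f +o H)"
    using image_mono[OF uminus_coset_subset[of "- f"], of uminus] by (simp add: image_image)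
qed

end

lemma UN_coset:
  assumes "add_subgroup H" "add_subgroup K"
    and add: "\<And>x y. k (x + y) = k x + k y" and maps: "\<And>x. x \<in> H \<Longrightarrow> k x \<in> K"
  shows "(\<Union>x\<in>f +o H. k x +o K) = k f +o K"
proof -
  interpret H: add_subgroup H by fact
  interpret K: add_subgroup K by fact
  have "k x +o K = k f +o K" if "x \<in> f +o H" for x
  proof -
    have "k (x - f) \<in> K" using that by (intro maps set_plus_imp_minus)
    moreover have "k x = k (x - f) + k f" by (metis add diff_add_cancel)
    ultimately show ?thesis by (simp add: K.coset_eq_iff)
  qed
  then show ?thesis using H.mem_coset_self by blast
qed

lemma UN_coset2:
  assumes "add_subgroup H" "add_subgroup H'" "add_subgroup K"
    and "\<And>x y z. k (x + y) z = k x z + k y z" "\<And>x y z. k z (x + y) = k z x + k z y"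
    and "\<And>x y. x \<in> H \<Longrightarrow> k x y \<in> K" "\<And>x y. y \<in> H' \<Longrightarrow> k x y \<in> K"
  shows "(\<Union>x\<in>f +o H. \<Union>y\<in>g +o H'. k x y +o K) = k f g +o K"
  using UN_coset[OF assms(2,3), of "k x" for x] UN_coset[OF assms(1,3), of "\<lambda>x. k x g"] assms(4-)
  by simp


section \<open>Tensor products as quotients of free abelian groups\<close>

definition frag_eval :: "('b \<Rightarrow> 'c::ring_1) \<Rightarrow> ('b \<Rightarrow>\<^sub>0 int) \<Rightarrow> 'c" where
  "frag_eval h f = (\<Sum>p\<in>Poly_Mapping.keys f. of_int (Poly_Mapping.lookup f p) * h p)"

lemma frag_eval_superset:
  assumes "finite S" "Poly_Mapping.keys f \<subseteq> S"
  shows "frag_eval h f = (\<Sum>p\<in>S. of_int (Poly_Mapping.lookup f p) * h p)"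
  unfolding frag_eval_def
  by (rule sum.mono_neutral_left) (use assms in \<open>auto simp: in_keys_iff\<close>)

lemma frag_eval_0 [simp]: "frag_eval h 0 = 0"
  by (simp add: frag_eval_def)

lemma frag_eval_of [simp]: "frag_eval h (frag_of p) = h p"
  by (simp add: frag_eval_def)

lemma frag_eval_add: "frag_eval h (f + g) = frag_eval h f + frag_eval h g"
proof -
  let ?S = "Poly_Mapping.keys f \<union> Poly_Mapping.keys g"
  have "Poly_Mapping.keys (f + g) \<subseteq> ?S" by (rule keys_add)
  then show ?thesis
    by (simp add: frag_eval_superset[of ?S] lookup_add distrib_right sum.distrib)
qed

lemma frag_eval_diff: "frag_eval h (f - g) = frag_eval h f - frag_eval h g"
  using frag_eval_add[of h "f - g" g] by simp

lemma frag_eval_of_sum: "frag_eval h (\<Sum>i\<in>I. f i) = (\<Sum>i\<in>I. frag_eval h (f i))"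
  by (induction I rule: infinite_finite_induct) (simp_all add: frag_eval_add)

lemma frag_eval_additive:
  assumes "additive m"
  shows "m (frag_eval h f) = frag_eval (\<lambda>p. m (h p)) f"
  by (rule frag_induction[where S = UNIV and c = f])
    (auto simp: frag_eval_diff additive.zero[OF assms] additive.diff[OF assms])

lemma frag_eval_mult_left: "frag_eval (\<lambda>p. c * h p) f = c * frag_eval h f"
  by (rule frag_eval_additive[symmetric]) (simp add: additive_def distrib_left)

lemma frag_eval_mult_right: "frag_eval (\<lambda>p. h p * c) f = frag_eval h f * c"
  by (rule frag_eval_additive[symmetric, of "\<lambda>x. x * c"]) (simp add: additive_def distrib_right)

lemma frag_eval_distrib: "frag_eval (\<lambda>p. h p + h' p) f = frag_eval h f + frag_eval h' f"
  by (simp add: frag_eval_def distrib_left sum.distrib)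

lemma frag_eval_sum: "frag_eval (\<lambda>p. \<Sum>i\<in>I. h i p) f = (\<Sum>i\<in>I. frag_eval (h i) f)"
  unfolding frag_eval_def sum_distrib_left by (rule sum.swap)

lemma frag_eval_extend: "frag_eval h (frag_extend k f) = frag_eval (\<lambda>p. frag_eval h (k p)) f"
  by (rule frag_induction[where S = UNIV and c = f])
    (auto simp: frag_eval_diff frag_extend_diff)

lemma frag_eval_cong:
  "(\<And>p. p \<in> Poly_Mapping.keys f \<Longrightarrow> h p = h' p) \<Longrightarrow> frag_eval h f = frag_eval h' f"
  by (simp add: frag_eval_def)

lemma tensor_lift_coset:
  assumes "add_subgroup H" and vanish: "\<And>x. x \<in> H \<Longrightarrow> frag_eval h x = 0"
  shows "tensor_lift h (f +o H) = frag_eval h f"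
proof -
  interpret add_subgroup H by fact
  have "frag_eval h x = frag_eval h f" if "x \<in> f +o H" for x
    using vanish[OF set_plus_imp_minus[OF that]] by (simp add: frag_eval_diff)
  then have "frag_eval h ` (f +o H) = {frag_eval h f}" using mem_coset_self by blast
  then show ?thesis unfolding tensor_lift_def frag_eval_def[abs_def] by simp
qed

interpretation tensor_ker: add_subgroup "tensor_ker M R ract N lact" for M R ract N lact
  by unfold_locales (auto simp: tensor_ker_def intro: group_closure.diff)

lemma tensor_ker_rules:
  shows tensor_ker_add_left: "x \<in> M \<Longrightarrow> x' \<in> M \<Longrightarrow> y \<in> N \<Longrightarrow>
      frag_of (x + x', y) - frag_of (x, y) - frag_of (x', y) \<in> tensor_ker M R ract N lact"
    and tensor_ker_add_right: "x \<in> M \<Longrightarrow> y \<in> N \<Longrightarrow> y' \<in> N \<Longrightarrow>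
      frag_of (x, y + y') - frag_of (x, y) - frag_of (x, y') \<in> tensor_ker M R ract N lact"
    and tensor_ker_balanced: "x \<in> M \<Longrightarrow> r \<in> R \<Longrightarrow> y \<in> N \<Longrightarrow>
      frag_of (ract x r, y) - frag_of (x, lact r y) \<in> tensor_ker M R ract N lact"
  unfolding tensor_ker_def by (rule group_closure.base, blast)+

lemma tensor_ker_induct [consumes 1, case_names zero add_left add_right balanced diff]:
  assumes "f \<in> tensor_ker M R ract N lact"
    and "P 0"
    and "\<And>x x' y. x \<in> M \<Longrightarrow> x' \<in> M \<Longrightarrow> y \<in> N \<Longrightarrow>
      P (frag_of (x + x', y) - frag_of (x, y) - frag_of (x', y))"
    and "\<And>x y y'. x \<in> M \<Longrightarrow> y \<in> N \<Longrightarrow> y' \<in> N \<Longrightarrow>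
      P (frag_of (x, y + y') - frag_of (x, y) - frag_of (x, y'))"
    and "\<And>x r y. x \<in> M \<Longrightarrow> r \<in> R \<Longrightarrow> y \<in> N \<Longrightarrow>
      P (frag_of (ract x r, y) - frag_of (x, lact r y))"
    and "\<And>f g. P f \<Longrightarrow> P g \<Longrightarrow> P (f - g)"
  shows "P f"
  using assms(1) unfolding tensor_ker_def
  by (induction rule: group_closure.induct) (auto intro: assms(2-))

lemma tensor_ker_vanish:
  assumes "f \<in> tensor_ker M R ract N lact"
    and "\<And>x x' y. x \<in> M \<Longrightarrow> x' \<in> M \<Longrightarrow> y \<in> N \<Longrightarrow> h (x + x', y) = h (x, y) + h (x', y)"
    and "\<And>x y y'. x \<in> M \<Longrightarrow> y \<in> N \<Longrightarrow> y' \<in> N \<Longrightarrow> h (x, y + y') = h (x, y) + h (x, y')"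
    and "\<And>x r y. x \<in> M \<Longrightarrow> r \<in> R \<Longrightarrow> y \<in> N \<Longrightarrow> h (ract x r, y) = h (x, lact r y)"
  shows "frag_eval h f = 0"
  using assms(1) by (induction rule: tensor_ker_induct) (simp_all add: frag_eval_diff assms(2-))

interpretation vtensor_ker: add_subgroup "vtensor_ker s s'" for s s'
  by unfold_locales (simp_all add: vtensor_ker_def tensor_ker.zero_mem tensor_ker.diff_mem)

lemma vtensor_eq_range: "vtensor s s' = range (\<lambda>f. f +o vtensor_ker s s')"
  by (auto simp: vtensor_def vtensor_ker_def tensor_carrier_def)

lemma vtensor_ker_rules:
  shows vtensor_ker_add_left:
      "frag_of (x + x', y) - frag_of (x, y) - frag_of (x', y) \<in> vtensor_ker s s'"
    and vtensor_ker_add_right: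
      "frag_of (x, y + y') - frag_of (x, y) - frag_of (x, y') \<in> vtensor_ker s s'"
    and vtensor_ker_scale: "frag_of (s k x, y) - frag_of (x, s' k y) \<in> vtensor_ker s s'"
  using tensor_ker_balanced[of x UNIV k UNIV y UNIV "\<lambda>x k. s k x" s'] unfolding vtensor_ker_def
  by (simp_all add: tensor_ker_rules)

lemma vtensor_ker_zero_right: "frag_of (x, 0 :: 'b::ab_group_add) \<in> vtensor_ker s s'"
  using vtensor_ker.uminus_mem[OF vtensor_ker_add_right[of x 0 0 s s']] by simp

lemma vtensor_ker_diff_right:
  fixes y y' :: "'b::ab_group_add"
  shows "frag_of (x, y) - frag_of (x, y') - frag_of (x, y - y') \<in> vtensor_ker s s'"
  using vtensor_ker_add_right[of x "y - y'" y' s s'] by (simp add: algebra_simps)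

lemma vtensor_ker_sum_left:
  fixes f :: "'i \<Rightarrow> 'a::ab_group_add"
  assumes "finite I"
  shows "frag_of (\<Sum>i\<in>I. f i, y) - (\<Sum>i\<in>I. frag_of (f i, y)) \<in> vtensor_ker s s'"
  using assms
proof (induction I rule: finite_induct)
  case empty
  show ?case using vtensor_ker.uminus_mem[OF vtensor_ker_add_left[of 0 0 y s s']] by simp
next
  case (insert i I)
  have "(frag_of (f i + sum f I, y) - frag_of (f i, y) - frag_of (sum f I, y)) +
      (frag_of (sum f I, y) - (\<Sum>i\<in>I. frag_of (f i, y))) \<in> vtensor_ker s s'"
    by (intro vtensor_ker.add_mem vtensor_ker_add_left insert.IH)
  then show ?case using insert.hyps by (simp add: algebra_simps)
qed

definition balanced :: "('k \<Rightarrow> 'a::plus \<Rightarrow> 'a) \<Rightarrow> ('a \<times> 'a \<Rightarrow> 'c::plus) \<Rightarrow> bool" where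
  "balanced s h \<longleftrightarrow> (\<forall>a a' b. h (a + a', b) = h (a, b) + h (a', b)) \<and>
    (\<forall>a b b'. h (a, b + b') = h (a, b) + h (a, b')) \<and>
    (\<forall>k a b. h (s k a, b) = h (a, s k b))"

lemma balanced_flip: "balanced s (\<lambda>(a, b). h (b, a)) \<longleftrightarrow> balanced s h"
  unfolding balanced_def by auto

lemma balanced_vanish:
  assumes "balanced s h" "f \<in> vtensor_ker s s"
  shows "frag_eval h f = 0"
  using assms(2) unfolding vtensor_ker_def
  by (rule tensor_ker_vanish) (use assms(1) in \<open>auto simp: balanced_def\<close>)

lemma tensor_lift_balanced:
  assumes "balanced s h"
  shows "tensor_lift h (f +o vtensor_ker s s) = frag_eval h f"
  by (rule tensor_lift_coset[OF vtensor_ker.add_subgroup_axioms]) (rule balanced_vanish[OF assms])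


section \<open>Azumaya algebras\<close>

locale azumaya =
  fixes s :: "'k::field \<Rightarrow> 'a::ring_1 \<Rightarrow> 'a"
  assumes azumaya: "azumaya_algebra s"
begin

sublocale vector_space s
  using azumaya by (simp add: azumaya_algebra_def k_algebra_def)

lemma scale_mult_left: "s k a * b = s k (a * b)"
  and scale_mult_right: "a * s k b = s k (a * b)"
  using azumaya unfolding azumaya_algebra_def k_algebra_def by metis+

lemmas scale_mult = scale_mult_left scale_mult_right

lemma finite_spanning_set: obtains D where "finite D" "span D = UNIV"
  using azumaya by (auto simp: azumaya_algebra_def)

abbreviation sandwich_frag :: "('a \<times> 'a \<Rightarrow>\<^sub>0 int) \<Rightarrow> 'a \<Rightarrow> 'a" where
  "sandwich_frag f x \<equiv> frag_eval (\<lambda>(a, b). a * x * b) f"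

lemma balanced_sandwich: "balanced s (\<lambda>(a, b). a * x * b)"
  by (simp add: balanced_def algebra_simps scale_mult)

lemma sandwich_coset: "sandwich (f +o vtensor_ker s s) x = sandwich_frag f x"
  unfolding sandwich_def by (rule tensor_lift_balanced) (rule balanced_sandwich)

lemma vtensor_ker_iff: "f \<in> vtensor_ker s s \<longleftrightarrow> (\<forall>x. sandwich_frag f x = 0)"
proof
  show "f \<in> vtensor_ker s s \<Longrightarrow> \<forall>x. sandwich_frag f x = 0"
    using balanced_vanish balanced_sandwich by blast
  assume "\<forall>x. sandwich_frag f x = 0"
  then have "sandwich (f +o vtensor_ker s s) = sandwich (0 +o vtensor_ker s s)"
    unfolding sandwich_coset[abs_def] fun_eq_iff by simp
  moreover have "inj_on sandwich (vtensor s s)"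
    using azumaya unfolding azumaya_algebra_def by (blast dest: bij_betw_imp_inj_on)
  moreover have "f +o vtensor_ker s s \<in> vtensor s s" "0 +o vtensor_ker s s \<in> vtensor s s"
    unfolding vtensor_eq_range by blast+
  ultimately have "f +o vtensor_ker s s = 0 +o vtensor_ker s s" by (simp only: inj_on_eq_iff)
  then show "f \<in> vtensor_ker s s"
    by (simp only: vtensor_ker.coset_eq_iff) simp
qed

lemma balanced_sum_eqI:
  fixes h :: "'a \<times> 'a \<Rightarrow> 'c::ring_1"
  assumes "balanced s h"
    and "\<And>x. (\<Sum>i\<in>I. p i * x * q i) = (\<Sum>j\<in>J. p' j * x * q' j)"
  shows "(\<Sum>i\<in>I. h (p i, q i)) = (\<Sum>j\<in>J. h (p' j, q' j))"
proof -
  let ?f = "(\<Sum>i\<in>I. frag_of (p i, q i)) - (\<Sum>j\<in>J. frag_of (p' j, q' j))"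
  have "?f \<in> vtensor_ker s s"
    unfolding vtensor_ker_iff by (simp add: frag_eval_diff frag_eval_of_sum assms(2))
  from balanced_vanish[OF assms(1) this] show ?thesis
    by (simp add: frag_eval_diff frag_eval_of_sum)
qed

lemma linear_eq_sandwich:
  assumes "\<And>x y. f (x + y) = f x + f y" "\<And>k x. f (s k x) = s k (f x)"
  obtains N :: nat and a b where "\<And>x. (\<Sum>i<N. a i * x * b i) = f x"
proof -
  have "Vector_Spaces.linear s s f" by unfold_locales (auto simp: assms)
  moreover have "sandwich ` vtensor s s = {f. Vector_Spaces.linear s s f}"
    using azumaya unfolding azumaya_algebra_def by (blast dest: bij_betw_imp_surj_on)
  ultimately have "f \<in> sandwich ` vtensor s s" by simp
  then obtain g where "f = sandwich (g +o vtensor_ker s s)"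
    unfolding vtensor_eq_range by blast
  then have g: "f = sandwich_frag g" by (simp add: fun_eq_iff sandwich_coset)
  obtain e where e: "bij_betw e {..<card (Poly_Mapping.keys g)} (Poly_Mapping.keys g)"
    using ex_bij_betw_nat_finite[of "Poly_Mapping.keys g"] by (auto simp: atLeast0LessThan)
  have "f x = (\<Sum>p\<in>Poly_Mapping.keys g. of_int (Poly_Mapping.lookup g p) * fst p * x * snd p)" for x
    by (simp add: g frag_eval_def case_prod_unfold mult.assoc)
  then show ?thesis
    by (intro that[of "\<lambda>i. of_int (Poly_Mapping.lookup g (e i)) * fst (e i)" "\<lambda>i. snd (e i)"
          "card (Poly_Mapping.keys g)"])
      (simp add: sum.reindex_bij_betw[OF e, symmetric])
qed

lemma linear_form_exists:
  assumes "x \<noteq> 0"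
  obtains \<theta> :: "'a \<Rightarrow> 'k" where "\<And>x y. \<theta> (x + y) = \<theta> x + \<theta> y" "\<And>k x. \<theta> (s k x) = k * \<theta> x"
    "\<theta> x = 1"
proof -
  interpret pair: vector_space_pair s "(*) :: 'k \<Rightarrow> 'k \<Rightarrow> 'k"
    by unfold_locales (auto simp: algebra_simps)
  have "independent {x}" using assms by simp
  from pair.linear_independent_extend[OF this, of "\<lambda>_. 1"]
  obtain g where "Vector_Spaces.linear s (*) g" "g x = 1" by auto
  then show ?thesis
    using that[of g] pair.linear_add pair.linear_scale by blast
qed

lemma central_imp_scalar:
  assumes "\<And>x. c * x = x * c"
  obtains k where "c = s k 1"
proof -
  obtain \<theta> :: "'a \<Rightarrow> 'k" where \<theta>: "\<And>x y. \<theta> (x + y) = \<theta> x + \<theta> y"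
    "\<And>k x. \<theta> (s k x) = k * \<theta> x" "\<theta> 1 = 1"
    by (rule linear_form_exists[of 1]) auto
  obtain N :: nat and a b where ab: "\<And>x. (\<Sum>i<N. a i * x * b i) = s (\<theta> x) 1"
    by (rule linear_eq_sandwich[of "\<lambda>x. s (\<theta> x) 1"]) (auto simp: \<theta> scale_left_distrib)
  have "s (\<theta> c) 1 = (\<Sum>i<N. a i * c * b i)" by (rule ab[symmetric])
  also have "\<dots> = (\<Sum>i<N. c * (a i * 1 * b i))"
    using assms by (intro sum.cong) (metis mult.assoc mult.right_neutral)+
  also have "\<dots> = c" unfolding sum_distrib_left[symmetric] ab by (simp add: \<theta>)
  finally show ?thesis by (rule that[OF sym])
qed

lemma coordinates_exist:
  obtains m :: nat and e and co :: "nat \<Rightarrow> 'a \<Rightarrow> 'k" where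
    "\<And>x. (\<Sum>i<m. s (co i x) (e i)) = x"
    "\<And>i x y. co i (x + y) = co i x + co i y" "\<And>i k x. co i (s k x) = k * co i x"
    "\<And>i j. i < m \<Longrightarrow> j < m \<Longrightarrow> co i (e j) = (if i = j then 1 else 0)"
proof -
  obtain D where D: "finite D" "span D = UNIV" by (rule finite_spanning_set)
  obtain B where B: "independent B" "span B = UNIV" by (rule basis_exists[of UNIV]) auto
  have "finite B" using independent_span_bound[OF D(1) B(1)] D(2) by auto
  then obtain e where e: "bij_betw e {..<card B} B"
    using ex_bij_betw_nat_finite[of B] by (auto simp: atLeast0LessThan)
  show ?thesis
  proof (rule that[of "\<lambda>i x. representation B x (e i)" e "card B"])
    fix x
    have "(\<Sum>v\<in>B. s (representation B x v) v) = x"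
      by (rule sum_representation_eq) (use B \<open>finite B\<close> in auto)
    then show "(\<Sum>i<card B. s (representation B x (e i)) (e i)) = x"
      by (simp add: sum.reindex_bij_betw[OF e, of "\<lambda>v. s (representation B x v) v"])
  next
    fix i j assume "i < card B" "j < card B"
    then have "e j \<in> B" "e i = e j \<longleftrightarrow> i = j"
      using e by (auto simp: bij_betw_def inj_on_eq_iff)
    then show "representation B (e j) (e i) = (if i = j then 1 else 0)"
      by (simp add: representation_basis[OF B(1)])
  qed (use B in \<open>auto simp: representation_add representation_scale\<close>)
qed

end


section \<open>Matrices\<close>

lemma mat_mult_assoc:
  fixes A B C :: "'c::semiring_0 mat"
  shows "dim_col A = dim_row B \<Longrightarrow> dim_col B = dim_row C \<Longrightarrow> A * B * C = A * (B * C)"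
  by (rule assoc_mult_mat[of A "dim_row A" "dim_col A" B "dim_col B" C "dim_col C"]) auto

lemma one_smult_mat: "1 \<cdot>\<^sub>m A = (A :: 'c::monoid_mult mat)"
  by (rule eq_matI) auto

lemma mult_mat_index:
  "A \<in> carrier_mat l m \<Longrightarrow> B \<in> carrier_mat m n \<Longrightarrow> i < l \<Longrightarrow> j < n \<Longrightarrow>
    (A * B) $$ (i, j) = (\<Sum>k<m. A $$ (i, k) * B $$ (k, j))"
  by (simp add: scalar_prod_def atLeast0LessThan)

lemma invertible_mat_imp_inverse:
  assumes G: "G \<in> carrier_mat n n" and "invertible_mat G"
  obtains H where "H \<in> carrier_mat n n" "G * H = 1\<^sub>m n" "H * G = 1\<^sub>m n"
proof -
  obtain H where GH: "G * H = 1\<^sub>m n" and HG: "H * G = 1\<^sub>m (dim_row H)"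
    using assms unfolding invertible_mat_def inverts_mat_def by auto
  moreover have "dim_col H = n" using arg_cong[OF GH, of dim_col] by simp
  moreover have "dim_row H = n" using arg_cong[OF HG, of dim_col] G by simp
  ultimately show ?thesis by (intro that[of H]) auto
qed

definition mat_trace :: "'c::comm_monoid_add mat \<Rightarrow> 'c" where
  "mat_trace A = (\<Sum>i<dim_row A. A $$ (i, i))"

lemma mat_trace_mult_comm:
  fixes A B :: "'c::comm_semiring_0 mat"
  assumes "A \<in> carrier_mat m n" "B \<in> carrier_mat n m"
  shows "mat_trace (A * B) = mat_trace (B * A)"
proof -
  have "mat_trace (A * B) = (\<Sum>i<m. \<Sum>k<n. A $$ (i, k) * B $$ (k, i))"
    unfolding mat_trace_def using assms by (intro sum.cong mult_mat_index) auto
  also have "\<dots> = (\<Sum>k<n. \<Sum>i<m. B $$ (k, i) * A $$ (i, k))"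
    by (subst sum.swap) (simp add: mult.commute)
  also have "\<dots> = mat_trace (B * A)"
    unfolding mat_trace_def using assms by (intro sum.cong mult_mat_index[symmetric]) auto
  finally show ?thesis .
qed

lemma mat_trace_add:
  "A \<in> carrier_mat n n \<Longrightarrow> B \<in> carrier_mat n n \<Longrightarrow> mat_trace (A + B) = mat_trace A + mat_trace B"
  by (auto simp: mat_trace_def sum.distrib)

lemma mat_trace_smult:
  fixes A :: "'c::semiring_0 mat"
  shows "A \<in> carrier_mat n n \<Longrightarrow> mat_trace (c \<cdot>\<^sub>m A) = c * mat_trace A"
  by (auto simp: mat_trace_def sum_distrib_left)

lemma mat_trace_transpose: "A \<in> carrier_mat n n \<Longrightarrow> mat_trace (transpose_mat A) = mat_trace A"
  by (auto simp: mat_trace_def)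

definition mat_sum :: "nat \<Rightarrow> nat \<Rightarrow> ('i \<Rightarrow> 'c::comm_monoid_add mat) \<Rightarrow> 'i set \<Rightarrow> 'c mat" where
  "mat_sum n m F I = mat n m (\<lambda>ij. \<Sum>i\<in>I. F i $$ ij)"

lemma mat_sum_simps [simp]:
  shows mat_sum_carrier: "mat_sum n m F I \<in> carrier_mat n m"
    and dim_mat_sum: "dim_row (mat_sum n m F I) = n" "dim_col (mat_sum n m F I) = m"
    and index_mat_sum: "i < n \<Longrightarrow> j < m \<Longrightarrow> mat_sum n m F I $$ (i, j) = (\<Sum>k\<in>I. F k $$ (i, j))"
  by (simp_all add: mat_sum_def)

lemma mult_mat_sum:
  fixes A :: "'c::semiring_0 mat"
  assumes "A \<in> carrier_mat l n" "\<And>i. i \<in> I \<Longrightarrow> F i \<in> carrier_mat n m"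
  shows "A * mat_sum n m F I = mat_sum l m (\<lambda>i. A * F i) I"
proof (rule eq_matI)
  fix p q assume "p < dim_row (mat_sum l m (\<lambda>i. A * F i) I)"
    "q < dim_col (mat_sum l m (\<lambda>i. A * F i) I)"
  then have pq: "p < l" "q < m" by simp_all
  have "(A * mat_sum n m F I) $$ (p, q) = (\<Sum>k<n. \<Sum>i\<in>I. A $$ (p, k) * F i $$ (k, q))"
    using pq by (simp add: mult_mat_index[OF assms(1) mat_sum_carrier] sum_distrib_left)
  also have "\<dots> = (\<Sum>i\<in>I. (A * F i) $$ (p, q))"
    using pq assms by (subst sum.swap)
      (auto intro!: sum.cong simp: mult_mat_index[of A l n _ m] simp del: index_mult_mat)
  finally show "(A * mat_sum n m F I) $$ (p, q) = mat_sum l m (\<lambda>i. A * F i) I $$ (p, q)"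
    using pq by simp
qed (use assms in auto)

lemma mat_sum_mult:
  fixes A :: "'c::semiring_0 mat"
  assumes "A \<in> carrier_mat m l" "\<And>i. i \<in> I \<Longrightarrow> F i \<in> carrier_mat n m"
  shows "mat_sum n m F I * A = mat_sum n l (\<lambda>i. F i * A) I"
proof (rule eq_matI)
  fix p q assume "p < dim_row (mat_sum n l (\<lambda>i. F i * A) I)"
    "q < dim_col (mat_sum n l (\<lambda>i. F i * A) I)"
  then have pq: "p < n" "q < l" by simp_all
  have "(mat_sum n m F I * A) $$ (p, q) = (\<Sum>k<m. \<Sum>i\<in>I. F i $$ (p, k) * A $$ (k, q))"
    using pq by (simp add: mult_mat_index[OF mat_sum_carrier assms(1)] sum_distrib_right)
  also have "\<dots> = (\<Sum>i\<in>I. (F i * A) $$ (p, q))"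
    using pq assms by (subst sum.swap)
      (auto intro!: sum.cong simp: mult_mat_index[of _ n m A l] simp del: index_mult_mat)
  finally show "(mat_sum n m F I * A) $$ (p, q) = mat_sum n l (\<lambda>i. F i * A) I $$ (p, q)"
    using pq by simp
qed (use assms in auto)

lemma mat_trace_mat_sum:
  assumes "\<And>i. i \<in> I \<Longrightarrow> F i \<in> carrier_mat n n"
  shows "mat_trace (mat_sum n n F I) = (\<Sum>i\<in>I. mat_trace (F i))"
proof -
  have "mat_trace (mat_sum n n F I) = (\<Sum>p<n. \<Sum>i\<in>I. F i $$ (p, p))" by (simp add: mat_trace_def)
  also have "\<dots> = (\<Sum>i\<in>I. \<Sum>p<n. F i $$ (p, p))" by (rule sum.swap)
  also have "\<dots> = (\<Sum>i\<in>I. mat_trace (F i))"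
    by (intro sum.cong refl) (use assms in \<open>auto simp: mat_trace_def\<close>)
  finally show ?thesis .
qed

definition mat_unit :: "nat \<Rightarrow> nat \<Rightarrow> nat \<Rightarrow> nat \<Rightarrow> 'c::zero_neq_one mat" where
  "mat_unit n m k l = mat n m (\<lambda>ij. if ij = (k, l) then 1 else 0)"

lemma mat_unit_carrier [simp]: "mat_unit n m k l \<in> carrier_mat n m"
  by (simp add: mat_unit_def)

lemma mat_unit_mult_index:
  fixes B :: "'c::semiring_1 mat"
  assumes "B \<in> carrier_mat m l" "i < n" "r < m" "q < l"
  shows "(mat_unit n m k r * B) $$ (i, q) = (if i = k then B $$ (r, q) else 0)"
proof -
  have "(mat_unit n m k r * B) $$ (i, q) =
      (\<Sum>j<m. if j = r then (if i = k then B $$ (r, q) else 0) else 0)"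
    unfolding mult_mat_index[OF mat_unit_carrier assms(1,2,4)]
    using assms(2) by (intro sum.cong) (auto simp: mat_unit_def)
  then show ?thesis using assms(3) by simp
qed

lemma mult_mat_unit_mult_index:
  fixes A B :: "'c::semiring_1 mat"
  assumes "A \<in> carrier_mat l n" "B \<in> carrier_mat m l'" "p < l" "k < n" "r < m" "q < l'"
  shows "(A * mat_unit n m k r * B) $$ (p, q) = A $$ (p, k) * B $$ (r, q)"
proof -
  have unit_mult: "mat_unit n m k r * B \<in> carrier_mat n l'"
    using mult_carrier_mat[OF mat_unit_carrier assms(2)] .
  have "(A * mat_unit n m k r * B) $$ (p, q) = (A * (mat_unit n m k r * B)) $$ (p, q)"
    by (simp only: assoc_mult_mat[OF assms(1) mat_unit_carrier assms(2)])
  also have "\<dots> = (\<Sum>i<n. A $$ (p, i) * (if i = k then B $$ (r, q) else 0))"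
    unfolding mult_mat_index[OF assms(1) unit_mult assms(3,6)]
    by (intro sum.cong) (simp_all only: lessThan_iff mat_unit_mult_index[OF assms(2) _ assms(5,6)])
  also have "\<dots> = A $$ (p, k) * B $$ (r, q)"
    using assms(4) by (simp add: if_distrib[of "(*) _"] cong: if_cong)
  finally show ?thesis .
qed

lemma mat_trace_mat_unit: "k < n \<Longrightarrow> mat_trace (mat_unit n n k l) = (if k = l then 1 else 0)"
  by (cases "k = l") (auto simp: mat_trace_def mat_unit_def intro: sum.neutral)

lemma commuting_imp_scalar_mat:
  fixes C :: "'c::comm_semiring_1 mat"
  assumes C: "C \<in> carrier_mat n n" and comm: "\<And>Y. Y \<in> carrier_mat n n \<Longrightarrow> C * Y = Y * C"
  shows "\<exists>t. C = t \<cdot>\<^sub>m 1\<^sub>m n"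
proof -
  have "C = C $$ (0, 0) \<cdot>\<^sub>m 1\<^sub>m n"
  proof (rule eq_matI)
    fix i j assume "i < dim_row (C $$ (0, 0) \<cdot>\<^sub>m 1\<^sub>m n)" "j < dim_col (C $$ (0, 0) \<cdot>\<^sub>m 1\<^sub>m n)"
    then have ij: "i < n" "j < n" by auto
    let ?E = "mat_unit n n j 0 :: 'c mat"
    have "(C * ?E * 1\<^sub>m n) $$ (i, 0) = C $$ (i, j)"
      using ij by (subst mult_mat_unit_mult_index[OF C one_carrier_mat]) auto
    moreover have "(1\<^sub>m n * ?E * C) $$ (i, 0) = 1\<^sub>m n $$ (i, j) * C $$ (0, 0)"
      using ij by (intro mult_mat_unit_mult_index[OF one_carrier_mat C]) auto
    moreover have "C * ?E * 1\<^sub>m n = 1\<^sub>m n * ?E * C"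
      using comm[of ?E] C by (simp add: right_mult_one_mat[of _ n n] left_mult_one_mat[of _ n n])
    ultimately show "C $$ (i, j) = (C $$ (0, 0) \<cdot>\<^sub>m 1\<^sub>m n) $$ (i, j)"
      using ij by (simp add: mult.commute)
  qed (use C in auto)
  then show ?thesis by blast
qed

lemma left_inverse_append:
  fixes P R :: "'c::comm_semiring_1 mat"
  assumes P: "P \<in> carrier_mat n k" and R: "R \<in> carrier_mat k n" and RP: "R * P = 1\<^sub>m k"
    and w: "w \<in> carrier_vec n" and r: "r \<in> carrier_vec n"
    and Rw: "R *\<^sub>v w = 0\<^sub>v k" and rP: "\<And>j. j < k \<Longrightarrow> r \<bullet> col P j = 0" and rw: "r \<bullet> w = 1"
  shows "mat_of_rows n (rows R @ [r]) * mat_of_cols n (cols P @ [w]) = 1\<^sub>m (Suc k)"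
    (is "?R * ?P = _")
proof (rule eq_matI)
  fix p q assume "p < dim_row (1\<^sub>m (Suc k) :: 'c mat)" "q < dim_col (1\<^sub>m (Suc k) :: 'c mat)"
  then have pq: "p < Suc k" "q < Suc k" by auto
  then have "(?R * ?P) $$ (p, q) = row ?R p \<bullet> col ?P q" using P R by simp
  moreover have "row ?R p = (if p < k then row R p else r)"
    using pq R r by (auto simp: nth_append mat_of_rows_row)
  moreover have "col ?P q = (if q < k then col P q else w)"
    using pq P w by (auto simp: nth_append col_mat_of_cols)
  moreover have "row R p \<bullet> col P q = 1\<^sub>m k $$ (p, q)" if "p < k" "q < k"
    using arg_cong[OF RP, of "\<lambda>A. A $$ (p, q)"] that R P by simp
  moreover have "row R p \<bullet> w = 0" if "p < k"
    using arg_cong[OF Rw, of "\<lambda>u. vec_index u p"] that R by simp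
  ultimately show "(?R * ?P) $$ (p, q) = 1\<^sub>m (Suc k) $$ (p, q)"
    using pq by (auto simp: rP rw)
qed (use P R in auto)

lemma mult_append_col_eq_0:
  fixes D P :: "'c::semiring_0 mat"
  assumes D: "D \<in> carrier_mat m n" and P: "P \<in> carrier_mat n k" and DP: "D * P = 0\<^sub>m m k"
    and w: "w \<in> carrier_vec n" and Dw: "D *\<^sub>v w = 0\<^sub>v m"
  shows "D * mat_of_cols n (cols P @ [w]) = 0\<^sub>m m (Suc k)" (is "D * ?P = _")
proof (rule eq_matI)
  fix p q assume "p < dim_row (0\<^sub>m m (Suc k) :: 'c mat)" "q < dim_col (0\<^sub>m m (Suc k) :: 'c mat)"
  then have pq: "p < m" "q < Suc k" by auto
  have "col ?P q = (if q < k then col P q else w)"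
    using pq P w by (auto simp: nth_append col_mat_of_cols)
  moreover have "row D p \<bullet> col P q = 0" if "q < k"
    using arg_cong[OF DP, of "\<lambda>A. A $$ (p, q)"] that pq D P by simp
  moreover have "row D p \<bullet> w = 0" using arg_cong[OF Dw, of "\<lambda>u. vec_index u p"] pq D by simp
  ultimately show "(D * ?P) $$ (p, q) = 0\<^sub>m m (Suc k) $$ (p, q)"
    using pq D P by simp
qed (use D P in auto)

lemma separating_row_exists:
  fixes P :: "'c::field mat"
  assumes P: "P \<in> carrier_mat n k" and R: "R \<in> carrier_mat k n" and RP: "R * P = 1\<^sub>m k"
    and w: "w \<in> carrier_vec n" "w \<noteq> 0\<^sub>v n" and Rw: "R *\<^sub>v w = 0\<^sub>v k"
  obtains r where "r \<in> carrier_vec n" "\<And>j. j < k \<Longrightarrow> r \<bullet> col P j = 0" "r \<bullet> w = 1"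
proof -
  define Z where "Z = 1\<^sub>m n - P * R"
  have PR: "P * R \<in> carrier_mat n n" and Z: "Z \<in> carrier_mat n n" using P R by (auto simp: Z_def)
  have "P * R * P = P" using P by (simp add: assoc_mult_mat[OF P R P] RP)
  then have ZP: "Z * P = 0\<^sub>m n k"
    using P PR by (simp add: Z_def minus_mult_distrib_mat[OF one_carrier_mat PR P])
  have "P *\<^sub>v 0\<^sub>v k = 0\<^sub>v n" using P by (intro eq_vecI) auto
  then have Zw: "Z *\<^sub>v w = w"
    using w(1) by (simp add: Z_def minus_mult_distrib_mat_vec[OF one_carrier_mat PR w(1)]
        assoc_mult_mat_vec[OF P R w(1)] Rw)
  obtain i where i: "i < n" "w $ i \<noteq> 0" using w by (metis carrier_vecD eq_vecI index_zero_vec)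
  let ?r = "inverse (w $ i) \<cdot>\<^sub>v row Z i"
  have "?r \<in> carrier_vec n" using Z by (simp add: carrier_vecI)
  moreover have "?r \<bullet> col P j = 0" if "j < k" for j
    using arg_cong[OF ZP, of "\<lambda>A. A $$ (i, j)"] that i Z P by simp
  moreover have "?r \<bullet> w = 1"
    using arg_cong[OF Zw, of "\<lambda>u. vec_index u i"] i Z w(1) by simp
  ultimately show ?thesis by (rule that)
qed

text \<open>A kernel vector that \<open>P R\<close> does not fix extends \<open>P\<close> by a column and \<open>R\<close> by a row.\<close>

lemma kernel_projection_extend:
  fixes D :: "'l::field mat"
  assumes D: "D \<in> carrier_mat m n" and P: "P \<in> carrier_mat n k" and R: "R \<in> carrier_mat k n"
    and RP: "R * P = 1\<^sub>m k" and DP: "D * P = 0\<^sub>m m k"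
    and v: "v \<in> carrier_vec n" "D *\<^sub>v v = 0\<^sub>v m" "P *\<^sub>v (R *\<^sub>v v) \<noteq> v"
  shows "\<exists>P'\<in>carrier_mat n (Suc k). \<exists>R'\<in>carrier_mat (Suc k) n.
    R' * P' = 1\<^sub>m (Suc k) \<and> D * P' = 0\<^sub>m m (Suc k)"
proof -
  define w where "w = v - P *\<^sub>v (R *\<^sub>v v)"
  have w: "w \<in> carrier_vec n"
    and Rv: "R *\<^sub>v v \<in> carrier_vec k" and PRv: "P *\<^sub>v (R *\<^sub>v v) \<in> carrier_vec n"
    using P R v by (auto simp: w_def)
  have "R *\<^sub>v (P *\<^sub>v (R *\<^sub>v v)) = R *\<^sub>v v"
    using Rv by (simp add: assoc_mult_mat_vec[OF R P Rv, symmetric] RP)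
  then have Rw: "R *\<^sub>v w = 0\<^sub>v k" using R Rv v(1) PRv by (simp add: w_def mult_minus_distrib_mat_vec)
  have "D *\<^sub>v (P *\<^sub>v (R *\<^sub>v v)) = 0\<^sub>v m"
    using Rv by (intro eq_vecI) (simp_all add: assoc_mult_mat_vec[OF D P Rv, symmetric] DP)
  then have Dw: "D *\<^sub>v w = 0\<^sub>v m" using D v PRv by (simp add: w_def mult_minus_distrib_mat_vec)
  have w_nonzero: "w \<noteq> 0\<^sub>v n"
  proof
    assume "w = 0\<^sub>v n"
    then have "v = P *\<^sub>v (R *\<^sub>v v)" using v(1) PRv by (intro eq_vecI) (auto simp: w_def vec_eq_iff)
    with v(3) show False by simp
  qed
  obtain r where r: "r \<in> carrier_vec n" "\<And>j. j < k \<Longrightarrow> r \<bullet> col P j = 0" "r \<bullet> w = 1"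
    by (rule separating_row_exists[OF P R RP w w_nonzero Rw]) (rule that)
  have "mat_of_cols n (cols P @ [w]) \<in> carrier_mat n (Suc k)"
    "mat_of_rows n (rows R @ [r]) \<in> carrier_mat (Suc k) n"
    using P R by auto
  then show ?thesis
    using left_inverse_append[OF P R RP w r(1) Rw r(2,3)] mult_append_col_eq_0[OF D P DP w Dw]
    by blast
qed

lemma kernel_projection_exists:
  fixes D :: "'l::field mat"
  assumes D: "D \<in> carrier_mat m n"
  obtains k P R where "P \<in> carrier_mat n k" "R \<in> carrier_mat k n" "R * P = 1\<^sub>m k" "k \<le> n"
    "D * P = 0\<^sub>m m k" "\<And>v. v \<in> carrier_vec n \<Longrightarrow> D *\<^sub>v v = 0\<^sub>v m \<Longrightarrow> P *\<^sub>v (R *\<^sub>v v) = v"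
proof -
  define admissible where "admissible k \<longleftrightarrow> k \<le> n \<and> (\<exists>P\<in>carrier_mat n k. \<exists>R\<in>carrier_mat k n.
    R * P = 1\<^sub>m k \<and> D * P = 0\<^sub>m m k)" for k
  define k where "k = Greatest admissible"
  have "(0\<^sub>m 0 n * 0\<^sub>m n 0 :: 'l mat) = 1\<^sub>m 0" "D * 0\<^sub>m n 0 = 0\<^sub>m m 0"
    using D by (auto intro: eq_matI)
  then have "admissible 0" unfolding admissible_def using zero_carrier_mat by blast
  moreover have bound: "j \<le> n" if "admissible j" for j using that by (simp add: admissible_def)
  ultimately have "admissible k" unfolding k_def by (rule GreatestI_nat)
  then obtain P R where PR: "P \<in> carrier_mat n k" "R \<in> carrier_mat k n" "R * P = 1\<^sub>m k"
    "D * P = 0\<^sub>m m k" "k \<le> n" by (auto simp: admissible_def)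
  have "P *\<^sub>v (R *\<^sub>v v) = v" if v: "v \<in> carrier_vec n" "D *\<^sub>v v = 0\<^sub>v m" for v
  proof (rule ccontr)
    assume not_fixed: "P *\<^sub>v (R *\<^sub>v v) \<noteq> v"
    have "\<not> admissible (Suc k)"
      using Greatest_le_nat[of admissible "Suc k" n] bound unfolding k_def by force
    moreover have "\<exists>P'\<in>carrier_mat n (Suc k). \<exists>R'\<in>carrier_mat (Suc k) n.
        R' * P' = 1\<^sub>m (Suc k) \<and> D * P' = 0\<^sub>m m (Suc k)"
      by (rule kernel_projection_extend[OF D PR(1-4) v not_fixed])
    ultimately have "k = n" using PR(5) by (auto simp: admissible_def)
    then have "P * R = 1\<^sub>m n" using mat_mult_left_right_inverse[of R n P] PR(1-3) by simp
    then have "P *\<^sub>v (R *\<^sub>v v) = v"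
      using assoc_mult_mat_vec[OF PR(1,2) v(1)] v(1) by simp
    with not_fixed show False ..
  qed
  with PR show ?thesis using that by blast
qed


section \<open>Irreducible matrix representations\<close>

locale matrix_rep =
  fixes s :: "'k::field \<Rightarrow> 'a::ring_1 \<Rightarrow> 'a" and n :: nat and \<phi> :: "'a \<Rightarrow> 'k alg_closure mat"
  assumes rep_carrier [simp]: "\<phi> x \<in> carrier_mat n n"
    and rep_one: "\<phi> 1 = 1\<^sub>m n"
    and rep_mult: "\<phi> (x * y) = \<phi> x * \<phi> y"
    and rep_add: "\<phi> (x + y) = \<phi> x + \<phi> y"
    and rep_scale: "\<phi> (s k x) = to_ac k \<cdot>\<^sub>m \<phi> x"
begin

lemma rep_dim [simp]: "dim_row (\<phi> x) = n" "dim_col (\<phi> x) = n"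
  using carrier_matD[OF rep_carrier] by auto

lemma rep_add_index: "i < n \<Longrightarrow> j < n \<Longrightarrow> \<phi> (x + y) $$ (i, j) = \<phi> x $$ (i, j) + \<phi> y $$ (i, j)"
  by (simp add: rep_add)

lemma rep_scale_index: "i < n \<Longrightarrow> j < n \<Longrightarrow> \<phi> (s k x) $$ (i, j) = to_ac k * \<phi> x $$ (i, j)"
  by (simp add: rep_scale)

lemma rep_sum: "\<phi> (\<Sum>i\<in>I. f i) = mat_sum n n (\<lambda>i. \<phi> (f i)) I" (is "_ = ?S")
proof (rule eq_matI)
  fix p q assume "p < dim_row ?S" "q < dim_col ?S"
  then have pq: "p < n" "q < n" by simp_all
  have "\<phi> 0 $$ (p, q) = 0"
    using rep_add_index[OF pq, of 0 0] by (metis add_cancel_right_right add_0)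
  then have "\<phi> (\<Sum>i\<in>I. f i) $$ (p, q) = (\<Sum>i\<in>I. \<phi> (f i) $$ (p, q))"
    by (induction I rule: infinite_finite_induct) (simp_all add: rep_add_index[OF pq])
  then show "\<phi> (\<Sum>i\<in>I. f i) $$ (p, q) = ?S $$ (p, q)" using pq by simp
qed simp_all

lemma rep_trace_add: "mat_trace (\<phi> (x + y)) = mat_trace (\<phi> x) + mat_trace (\<phi> y)"
  unfolding rep_add by (rule mat_trace_add[OF rep_carrier rep_carrier])

lemma rep_trace_scale: "mat_trace (\<phi> (s k x)) = to_ac k * mat_trace (\<phi> x)"
  unfolding rep_scale by (rule mat_trace_smult[OF rep_carrier])

lemma rep_trace_mult_comm: "mat_trace (\<phi> (x * y)) = mat_trace (\<phi> (y * x))"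
  unfolding rep_mult by (rule mat_trace_mult_comm[OF rep_carrier rep_carrier])

lemma compression_rep:
  assumes P: "P \<in> carrier_mat n k" and R: "R \<in> carrier_mat k n" and RP: "R * P = 1\<^sub>m k"
    and stable: "\<And>x. P * (R * (\<phi> x * P)) = \<phi> x * P"
  shows "matrix_rep s k (\<lambda>x. R * \<phi> x * P)"
proof
  fix x y c
  show "R * \<phi> x * P \<in> carrier_mat k k" using P R by (intro carrier_matI) auto
  show "R * \<phi> 1 * P = 1\<^sub>m k" using P R RP by (simp add: rep_one)
  show "R * \<phi> (x * y) * P = R * \<phi> x * P * (R * \<phi> y * P)"
    using P R by (simp add: rep_mult mat_mult_assoc stable)
  show "R * \<phi> (x + y) * P = R * \<phi> x * P + R * \<phi> y * P"
    using P R by (simp add: rep_add mult_add_distrib_mat[of _ k n _ n]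
        add_mult_distrib_mat[of _ k n _ _ k])
  show "R * \<phi> (s c x) * P = to_ac c \<cdot>\<^sub>m (R * \<phi> x * P)"
    using P R by (simp add: rep_scale mult_smult_distrib[of _ k n _ n]
        mult_smult_assoc_mat[of _ k n _ k])
qed

lemma kernel_subrep:
  assumes D: "D \<in> carrier_mat n n" and comm: "\<And>x. D * \<phi> x = \<phi> x * D" and "D \<noteq> 0\<^sub>m n n"
    and v: "v \<in> carrier_vec n" "v \<noteq> 0\<^sub>v n" "D *\<^sub>v v = 0\<^sub>v n"
  shows "\<exists>k \<psi>. 0 < k \<and> k < n \<and> matrix_rep s k \<psi>"
proof -
  obtain k P R where PR: "P \<in> carrier_mat n k" "R \<in> carrier_mat k n" "R * P = 1\<^sub>m k" "k \<le> n"
    "D * P = 0\<^sub>m n k"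
    and fixed: "\<And>v. v \<in> carrier_vec n \<Longrightarrow> D *\<^sub>v v = 0\<^sub>v n \<Longrightarrow> P *\<^sub>v (R *\<^sub>v v) = v"
    by (rule kernel_projection_exists[OF D]) (rule that)
  have stable: "P * (R * (\<phi> x * P)) = \<phi> x * P" for x
  proof (rule mat_col_eqI)
    fix j assume "j < dim_col (\<phi> x * P)"
    then have j: "j < k" using PR by simp
    have \<phi>P: "\<phi> x * P \<in> carrier_mat n k" using PR by (intro carrier_matI) auto
    have "D * (\<phi> x * P) = D * \<phi> x * P" using PR D by (simp add: mat_mult_assoc)
    also have "\<dots> = \<phi> x * (D * P)" unfolding comm using PR D by (simp add: mat_mult_assoc)
    also have "\<dots> = 0\<^sub>m n k" using PR by simp
    finally have "D *\<^sub>v col (\<phi> x * P) j = 0\<^sub>v n"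
      using col_mult2[OF D \<phi>P j] j by simp
    then show "col (P * (R * (\<phi> x * P))) j = col (\<phi> x * P) j"
      using fixed[of "col (\<phi> x * P) j"] \<phi>P j
      by (simp add: col_mult2[OF PR(1) mult_carrier_mat[OF PR(2) \<phi>P]] col_mult2[OF PR(2) \<phi>P])
  qed (use PR in auto)
  have "k \<noteq> 0"
  proof
    assume "k = 0"
    then have "P *\<^sub>v (R *\<^sub>v v) = 0\<^sub>v n"
      using PR v(1) by (intro eq_vecI) (auto simp: scalar_prod_def)
    then show False using fixed[OF v(1,3)] v(2) by simp
  qed
  moreover have "k \<noteq> n"
  proof
    assume "k = n"
    then have "P * R = 1\<^sub>m n" using mat_mult_left_right_inverse[of R n P] PR by simp
    then have "D = D * (P * R)" using D by simp
    also have "\<dots> = D * P * R" using D PR(1,2) by (simp add: mat_mult_assoc)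
    also have "\<dots> = 0\<^sub>m n n" using PR(2,5) by simp
    finally show False using \<open>D \<noteq> 0\<^sub>m n n\<close> by contradiction
  qed
  ultimately show ?thesis using compression_rep[OF PR(1-3) stable] PR(4) by force
qed

end

locale irrep = matrix_rep s n \<phi>
  for s :: "'k::field \<Rightarrow> 'a::ring_1 \<Rightarrow> 'a" and n \<phi> +
  assumes dim_pos: "0 < n"
    and schur: "C \<in> carrier_mat n n \<Longrightarrow> (\<And>x. C * \<phi> x = \<phi> x * C) \<Longrightarrow> \<exists>t. C = t \<cdot>\<^sub>m 1\<^sub>m n"

lemma (in matrix_rep) minimal_dim_imp_irrep:
  assumes "0 < n" and minimal: "\<And>k \<psi>. 0 < k \<Longrightarrow> k < n \<Longrightarrow> \<not> matrix_rep s k \<psi>"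
  shows "irrep s n \<phi>"
proof
  fix C
  assume C: "C \<in> carrier_mat n n" and comm: "\<And>x. C * \<phi> x = \<phi> x * C"
  have "degree (char_poly C) > 0" using degree_monic_char_poly[OF C] \<open>0 < n\<close> by simp
  then obtain t where "poly (char_poly C) t = 0" using alg_closed_imp_poly_has_root by blast
  then have "eigenvalue C t" by (simp add: eigenvalue_root_char_poly[OF C])
  then obtain v where v: "v \<in> carrier_vec n" "v \<noteq> 0\<^sub>v n" "char_matrix C t *\<^sub>v v = 0\<^sub>v n"
    unfolding eigenvalue_char_matrix[OF C] by blast
  have "char_matrix C t * \<phi> x = \<phi> x * char_matrix C t" for x
    using C by (simp add: char_matrix_def comm add_mult_distrib_mat[of _ n n _ _ n]
        mult_add_distrib_mat[of _ n n _ n] mult_smult_assoc_mat[of _ n n _ n]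
        mult_smult_distrib[of _ n n _ n])
  then have "char_matrix C t = 0\<^sub>m n n"
    using kernel_subrep[OF char_matrix_closed[OF C] _ _ v] minimal by blast
  then have "char_matrix C t $$ (i, j) = 0" if "i < n" "j < n" for i j using that by simp
  then have "C = t \<cdot>\<^sub>m 1\<^sub>m n"
    using C by (intro eq_matI) (auto simp: char_matrix_def add_eq_0_iff2)
  then show "\<exists>t. C = t \<cdot>\<^sub>m 1\<^sub>m n" ..
qed fact

context azumaya
begin

lemma regular_rep_exists: "\<exists>n \<phi>. 0 < n \<and> matrix_rep s n \<phi>"
proof -
  obtain m :: nat and e and co :: "nat \<Rightarrow> 'a \<Rightarrow> 'k" where co: "\<And>x. (\<Sum>i<m. s (co i x) (e i)) = x"
    "\<And>i x y. co i (x + y) = co i x + co i y" "\<And>i k x. co i (s k x) = k * co i x"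
    "\<And>i j. i < m \<Longrightarrow> j < m \<Longrightarrow> co i (e j) = (if i = j then 1 else 0)"
    by (rule coordinates_exist) blast
  define \<phi> where "\<phi> x = mat m m (\<lambda>(i, j). to_ac (co i (x * e j)))" for x
  have "0 < m" using co(1)[of 1] by (cases m) auto
  moreover have "matrix_rep s m \<phi>"
  proof
    fix x y k
    have co_0: "co i 0 = 0" for i using co(2)[of i 0 0] by (metis add_cancel_right_right add_0)
    have co_sum: "co i (\<Sum>k\<in>I. f k) = (\<Sum>k\<in>I. co i (f k))" for i and I :: "nat set" and f
      by (induction I rule: infinite_finite_induct) (simp_all add: co(2) co_0)
    show "\<phi> x \<in> carrier_mat m m" by (simp add: \<phi>_def)
    show "\<phi> 1 = 1\<^sub>m m" by (rule eq_matI) (simp_all add: \<phi>_def co(4))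
    show "\<phi> (x * y) = \<phi> x * \<phi> y"
    proof (rule eq_matI)
      fix i j assume "i < dim_row (\<phi> x * \<phi> y)" "j < dim_col (\<phi> x * \<phi> y)"
      then have ij: "i < m" "j < m" by (simp_all add: \<phi>_def)
      have "x * (y * e j) = (\<Sum>k<m. s (co k (y * e j)) (x * e k))"
        using arg_cong[OF co(1)[of "y * e j"], of "(*) x"]
        by (simp add: sum_distrib_left scale_mult)
      then have "co i (x * y * e j) = (\<Sum>k<m. co i (x * e k) * co k (y * e j))"
        by (simp add: mult.assoc co_sum co(3) mult.commute)
      then show "\<phi> (x * y) $$ (i, j) = (\<phi> x * \<phi> y) $$ (i, j)"
        using ij by (simp add: \<phi>_def mult_mat_index[of _ m m _ m] to_ac_sum del: index_mult_mat)
    qed (simp_all add: \<phi>_def)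
    show "\<phi> (x + y) = \<phi> x + \<phi> y"
      by (rule eq_matI) (simp_all add: \<phi>_def distrib_right co(2))
    show "\<phi> (s k x) = to_ac k \<cdot>\<^sub>m \<phi> x"
      by (rule eq_matI) (simp_all add: \<phi>_def scale_mult co(3))
  qed
  ultimately show ?thesis by blast
qed

lemma irrep_exists: "\<exists>n \<phi>. irrep s n \<phi>"
proof -
  define rep_dim where "rep_dim n \<longleftrightarrow> 0 < n \<and> (\<exists>\<phi>. matrix_rep s n \<phi>)" for n
  define n where "n = (LEAST n. rep_dim n)"
  have "\<exists>n. rep_dim n" using regular_rep_exists unfolding rep_dim_def by blast
  then have "rep_dim n" unfolding n_def by (rule LeastI_ex)
  then obtain \<phi> where "0 < n" and \<phi>: "matrix_rep s n \<phi>" unfolding rep_dim_def by blast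
  moreover have "\<not> matrix_rep s k \<psi>" if "0 < k" "k < n" for k \<psi>
    using not_less_Least[of k rep_dim] that unfolding n_def rep_dim_def by blast
  ultimately have "irrep s n \<phi>" by (intro matrix_rep.minimal_dim_imp_irrep[OF \<phi>])
  then show ?thesis by blast
qed

end


section \<open>The tensor that acts as the involution\<close>

locale azumaya_involution = azumaya s for s :: "'k::field \<Rightarrow> 'a::ring_1 \<Rightarrow> 'a" +
  fixes \<sigma> :: "'a \<Rightarrow> 'a"
  assumes involution: "involution_first_kind s \<sigma>"
begin

lemma \<sigma>_add: "\<sigma> (x + y) = \<sigma> x + \<sigma> y"
  and \<sigma>_scale: "\<sigma> (s k x) = s k (\<sigma> x)"
  and \<sigma>_mult: "\<sigma> (x * y) = \<sigma> y * \<sigma> x"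
  and \<sigma>_\<sigma> [simp]: "\<sigma> (\<sigma> x) = x"
proof -
  have "Vector_Spaces.linear s s \<sigma>" using involution by (simp add: involution_first_kind_def)
  then interpret linear: Vector_Spaces.linear s s \<sigma> .
  show "\<sigma> (x + y) = \<sigma> x + \<sigma> y" "\<sigma> (s k x) = s k (\<sigma> x)"
    by (rule linear.add linear.scale)+
  show "\<sigma> (x * y) = \<sigma> y * \<sigma> x" "\<sigma> (\<sigma> x) = x"
    using involution by (simp_all add: involution_first_kind_def)
qed

lemma additive_\<sigma>: "additive \<sigma>"
  by (simp add: additive_def \<sigma>_add)

lemma \<sigma>_one [simp]: "\<sigma> 1 = 1"
  by (metis \<sigma>_\<sigma> \<sigma>_mult mult.left_neutral mult.right_neutral)

lemma balanced_twisted_sandwich: "balanced s (\<lambda>(a, b). a * x * \<sigma> b)"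
  by (simp add: balanced_def algebra_simps scale_mult \<sigma>_add \<sigma>_scale)

lemma balanced_twisted_sum_eqI:
  fixes h :: "'a \<times> 'a \<Rightarrow> 'c::ring_1"
  assumes h: "balanced s h"
    and eq: "\<And>x. (\<Sum>i\<in>I. p i * x * \<sigma> (q i)) = (\<Sum>j\<in>J. p' j * x * \<sigma> (q' j))"
  shows "(\<Sum>i\<in>I. h (p i, q i)) = (\<Sum>j\<in>J. h (p' j, q' j))"
proof -
  have "balanced s (\<lambda>(a, b). h (a, \<sigma> b))"
    using h by (simp add: balanced_def \<sigma>_add \<sigma>_scale)
  from balanced_sum_eqI[OF this, of p "\<lambda>i. \<sigma> (q i)" I p' "\<lambda>j. \<sigma> (q' j)" J] eq
  show ?thesis by simp
qed

end

locale swap_tensor = azumaya_involution s \<sigma>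
  for s :: "'k::field \<Rightarrow> 'a::ring_1 \<Rightarrow> 'a" and \<sigma> +
  fixes N :: nat and a b :: "nat \<Rightarrow> 'a"
  assumes twisted_sandwich: "(\<Sum>i<N. a i * x * \<sigma> (b i)) = \<sigma> x"

lemma (in azumaya_involution) swap_tensor_exists: "\<exists>N a b. swap_tensor s \<sigma> N a b"
proof -
  obtain N :: nat and a b where "\<And>x. (\<Sum>i<N. a i * x * b i) = \<sigma> x"
    by (rule linear_eq_sandwich[of \<sigma>]) (auto simp: \<sigma>_add \<sigma>_scale)
  then have "swap_tensor s \<sigma> N a (\<lambda>i. \<sigma> (b i))" by unfold_locales simp
  then show ?thesis by blast
qed

context swap_tensor
begin

lemma intertwine_outer:
  fixes h :: "'a \<times> 'a \<Rightarrow> 'c::ring_1"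
  assumes "balanced s h"
  shows "(\<Sum>i<N. h (x * a i, b i)) = (\<Sum>i<N. h (a i, b i * x))"
proof (rule balanced_twisted_sum_eqI[OF assms])
  fix v
  have "(\<Sum>i<N. x * a i * v * \<sigma> (b i)) = x * (\<Sum>i<N. a i * v * \<sigma> (b i))"
    by (simp add: sum_distrib_left mult.assoc)
  also have "\<dots> = (\<Sum>i<N. a i * (v * \<sigma> x) * \<sigma> (b i))"
    by (simp only: twisted_sandwich \<sigma>_mult \<sigma>_\<sigma>)
  finally show "(\<Sum>i<N. x * a i * v * \<sigma> (b i)) = (\<Sum>i<N. a i * v * \<sigma> (b i * x))"
    by (simp add: \<sigma>_mult mult.assoc)
qed

lemma intertwine_inner:
  fixes h :: "'a \<times> 'a \<Rightarrow> 'c::ring_1"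
  assumes "balanced s h"
  shows "(\<Sum>i<N. h (a i * x, b i)) = (\<Sum>i<N. h (a i, x * b i))"
proof (rule balanced_twisted_sum_eqI[OF assms])
  fix v
  have "(\<Sum>i<N. a i * x * v * \<sigma> (b i)) = (\<Sum>i<N. a i * (x * v) * \<sigma> (b i))"
    by (simp add: mult.assoc)
  also have "\<dots> = (\<Sum>i<N. a i * v * \<sigma> (b i)) * \<sigma> x"
    by (simp only: twisted_sandwich \<sigma>_mult)
  finally show "(\<Sum>i<N. a i * x * v * \<sigma> (b i)) = (\<Sum>i<N. a i * v * \<sigma> (x * b i))"
    by (simp add: \<sigma>_mult sum_distrib_right mult.assoc)
qed

definition \<tau> :: "'a \<Rightarrow> 'k" where
  "\<tau> x = (THE k. (\<Sum>i<N. a i * x * b i) = s k 1)"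

lemma sandwich_eq_\<tau>: "(\<Sum>i<N. a i * x * b i) = s (\<tau> x) 1"
proof -
  have "(\<Sum>i<N. a i * x * b i) * y = y * (\<Sum>i<N. a i * x * b i)" for y
    using intertwine_outer[OF balanced_sandwich, of x y]
    by (simp add: sum_distrib_left sum_distrib_right mult.assoc)
  then obtain k where "(\<Sum>i<N. a i * x * b i) = s k 1" by (rule central_imp_scalar)
  then have "\<exists>!k. (\<Sum>i<N. a i * x * b i) = s k 1" by auto
  then show ?thesis unfolding \<tau>_def by (rule theI')
qed

text \<open>The square of the tensor is \<open>1\<close>, because \<open>\<sigma>\<^sup>2 = id\<close>.\<close>

lemma \<tau>_dual: "(\<Sum>i<N. s (\<tau> (a i * x)) (b i)) = x"
proof -
  have "(\<Sum>i<N. s (\<tau> (a i * x)) (b i)) = (\<Sum>i<N. (\<Sum>j<N. a j * (a i * x) * b j) * b i)"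
    by (simp add: sandwich_eq_\<tau> scale_mult)
  also have "\<dots> = (\<Sum>(i, j)\<in>{..<N} \<times> {..<N}. a j * a i * x * (b j * b i))"
    by (simp add: sum.cartesian_product[symmetric] sum_distrib_right mult.assoc)
  also have "\<dots> = (\<Sum>p\<in>{..<N} \<times> {..<N}.
      (\<lambda>(y, z). y * x * z) (a (snd p) * a (fst p), b (snd p) * b (fst p)))"
    by (simp add: case_prod_unfold)
  also have "\<dots> = (\<Sum>p\<in>{()}. (\<lambda>(y, z). y * x * z) (1, 1))"
  proof (rule balanced_twisted_sum_eqI[OF balanced_sandwich])
    fix v
    have "(\<Sum>p\<in>{..<N} \<times> {..<N}. a (snd p) * a (fst p) * v * \<sigma> (b (snd p) * b (fst p))) =
        (\<Sum>i<N. \<Sum>j<N. a j * (a i * v * \<sigma> (b i)) * \<sigma> (b j))"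
      by (simp add: sum.cartesian_product case_prod_unfold \<sigma>_mult mult.assoc)
    also have "\<dots> = (\<Sum>i<N. \<sigma> (a i * v * \<sigma> (b i)))" by (simp only: twisted_sandwich)
    also have "\<dots> = v" by (simp only: additive.sum[OF additive_\<sigma>, symmetric] twisted_sandwich \<sigma>_\<sigma>)
    finally show "(\<Sum>p\<in>{..<N} \<times> {..<N}. a (snd p) * a (fst p) * v * \<sigma> (b (snd p) * b (fst p))) =
        (\<Sum>p\<in>{()}. 1 * v * \<sigma> 1)" by simp
  qed
  finally show ?thesis by simp
qed

lemma \<tau>_nonzero: "\<exists>x. \<tau> x \<noteq> 0"
proof (rule ccontr)
  assume "\<not> ?thesis"
  then show False using \<tau>_dual[of 1] by simp
qed


section \<open>The tensor in matrix representations\<close>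

definition rep_sandwich ::
  "('a \<Rightarrow> 'k alg_closure mat) \<Rightarrow> ('a \<Rightarrow> 'k alg_closure mat) \<Rightarrow> 'k alg_closure mat \<Rightarrow>
    'k alg_closure mat" where
  "rep_sandwich \<phi> \<psi> Y = mat_sum (dim_row Y) (dim_col Y) (\<lambda>i. \<phi> (a i) * Y * \<psi> (b i)) {..<N}"

lemma rep_sandwich_carrier [simp]: "Y \<in> carrier_mat n m \<Longrightarrow> rep_sandwich \<phi> \<psi> Y \<in> carrier_mat n m"
  by (auto simp: rep_sandwich_def)

lemma balanced_rep_entry:
  assumes "matrix_rep s n \<phi>" "matrix_rep s m \<psi>" and Y: "Y \<in> carrier_mat n m" and "p < n" "q < m"
  shows "balanced s (\<lambda>(x, y). (\<phi> x * Y * \<psi> y) $$ (p, q))"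
proof -
  interpret \<phi>: matrix_rep s n \<phi> by fact
  interpret \<psi>: matrix_rep s m \<psi> by fact
  have \<phi>Y: "\<phi> x * Y \<in> carrier_mat n m" for x using Y by (intro carrier_matI) auto
  show ?thesis
    unfolding balanced_def using assms(4,5) Y \<phi>Y
    by (simp add: \<phi>.rep_add \<phi>.rep_scale \<psi>.rep_add \<psi>.rep_scale add_mult_distrib_mat[of _ n n _ _ m]
        add_mult_distrib_mat[of _ n m _ _ m] mult_add_distrib_mat[of _ n m _ m]
        mult_smult_assoc_mat[of _ n n _ m] mult_smult_assoc_mat[of _ n m _ m]
        mult_smult_distrib[of _ n m _ m] del: index_mult_mat(1))
qed

lemma rep_sandwich_outer:
  assumes "matrix_rep s n \<phi>" "matrix_rep s m \<psi>" and Y: "Y \<in> carrier_mat n m"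
  shows "\<phi> x * rep_sandwich \<phi> \<psi> Y = rep_sandwich \<phi> \<psi> Y * \<psi> x"
proof -
  interpret \<phi>: matrix_rep s n \<phi> by fact
  interpret \<psi>: matrix_rep s m \<psi> by fact
  have summand: "\<phi> y * Y * \<psi> z \<in> carrier_mat n m" for y z using Y by (intro carrier_matI) auto
  have "\<phi> x * rep_sandwich \<phi> \<psi> Y = mat_sum n m (\<lambda>i. \<phi> x * (\<phi> (a i) * Y * \<psi> (b i))) {..<N}"
    using Y by (simp add: rep_sandwich_def mult_mat_sum[OF \<phi>.rep_carrier summand])
  also have "\<dots> = mat_sum n m (\<lambda>i. \<phi> (x * a i) * Y * \<psi> (b i)) {..<N}"
    using Y by (simp add: \<phi>.rep_mult mat_mult_assoc)
  also have "\<dots> = mat_sum n m (\<lambda>i. \<phi> (a i) * Y * \<psi> (b i * x)) {..<N}"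
    using intertwine_outer[OF balanced_rep_entry[OF assms]] by (intro eq_matI) simp_all
  also have "\<dots> = mat_sum n m (\<lambda>i. \<phi> (a i) * Y * \<psi> (b i) * \<psi> x) {..<N}"
    using Y by (simp add: \<psi>.rep_mult mat_mult_assoc)
  also have "\<dots> = rep_sandwich \<phi> \<psi> Y * \<psi> x"
    using Y by (simp add: rep_sandwich_def mat_sum_mult[OF \<psi>.rep_carrier summand])
  finally show ?thesis .
qed

definition flipped_rep_sandwich ::
  "('a \<Rightarrow> 'k alg_closure mat) \<Rightarrow> 'k alg_closure mat \<Rightarrow> 'k alg_closure mat" where
  "flipped_rep_sandwich \<phi> Y = mat_sum (dim_row Y) (dim_col Y) (\<lambda>i. \<phi> (b i) * Y * \<phi> (a i)) {..<N}"

lemma flipped_rep_sandwich_carrier [simp]: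
  "Y \<in> carrier_mat n m \<Longrightarrow> flipped_rep_sandwich \<phi> Y \<in> carrier_mat n m"
  by (auto simp: flipped_rep_sandwich_def)

lemma flipped_rep_sandwich_commute:
  assumes "matrix_rep s n \<phi>" and Y: "Y \<in> carrier_mat n n"
  shows "flipped_rep_sandwich \<phi> Y * \<phi> x = \<phi> x * flipped_rep_sandwich \<phi> Y"
proof -
  interpret matrix_rep s n \<phi> by fact
  have summand: "\<phi> y * Y * \<phi> z \<in> carrier_mat n n" for y z using Y by (intro carrier_matI) auto
  have "flipped_rep_sandwich \<phi> Y * \<phi> x = mat_sum n n (\<lambda>i. \<phi> (b i) * Y * \<phi> (a i) * \<phi> x) {..<N}"
    using Y by (simp add: flipped_rep_sandwich_def mat_sum_mult[OF rep_carrier summand])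
  also have "\<dots> = mat_sum n n (\<lambda>i. \<phi> (b i) * Y * \<phi> (a i * x)) {..<N}"
    using Y by (simp add: rep_mult mat_mult_assoc)
  also have "\<dots> = mat_sum n n (\<lambda>i. \<phi> (x * b i) * Y * \<phi> (a i)) {..<N}" (is "_ = ?R")
  proof (rule eq_matI)
    fix p q assume "p < dim_row ?R" "q < dim_col ?R"
    then have pq: "p < n" "q < n" by simp_all
    then have "balanced s (\<lambda>(x, y). (\<phi> y * Y * \<phi> x) $$ (p, q))"
      using balanced_rep_entry[OF matrix_rep_axioms matrix_rep_axioms Y]
      by (subst balanced_flip[symmetric]) simp
    from intertwine_inner[OF this, of x]
    show "mat_sum n n (\<lambda>i. \<phi> (b i) * Y * \<phi> (a i * x)) {..<N} $$ (p, q) = ?R $$ (p, q)"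
      using pq by simp
  qed simp_all
  also have "\<dots> = mat_sum n n (\<lambda>i. \<phi> x * (\<phi> (b i) * Y * \<phi> (a i))) {..<N}"
    using Y by (simp add: rep_mult mat_mult_assoc)
  also have "\<dots> = \<phi> x * flipped_rep_sandwich \<phi> Y"
    using Y by (simp add: flipped_rep_sandwich_def mult_mat_sum[OF rep_carrier summand])
  finally show ?thesis .
qed

lemma mat_trace_mult_rep_sandwich:
  assumes "matrix_rep s n \<phi>" and Y: "Y \<in> carrier_mat n n" and Z: "Z \<in> carrier_mat n n"
  shows "mat_trace (Z * rep_sandwich \<phi> \<phi> Y) = mat_trace (flipped_rep_sandwich \<phi> Z * Y)"
proof -
  interpret matrix_rep s n \<phi> by fact
  have summand: "\<phi> x * W * \<phi> y \<in> carrier_mat n n" if "W \<in> carrier_mat n n" for x y W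
    using that by (intro carrier_matI) auto
  have "mat_trace (Z * rep_sandwich \<phi> \<phi> Y) =
      mat_trace (mat_sum n n (\<lambda>i. Z * (\<phi> (a i) * Y * \<phi> (b i))) {..<N})"
    using Y by (simp add: rep_sandwich_def mult_mat_sum[OF Z summand[OF Y]])
  also have "\<dots> = (\<Sum>i<N. mat_trace (Z * (\<phi> (a i) * Y * \<phi> (b i))))"
    using Y Z by (intro mat_trace_mat_sum carrier_matI) auto
  also have "\<dots> = (\<Sum>i<N. mat_trace (\<phi> (b i) * Z * \<phi> (a i) * Y))"
  proof (rule sum.cong[OF refl])
    fix i
    show "mat_trace (Z * (\<phi> (a i) * Y * \<phi> (b i))) = mat_trace (\<phi> (b i) * Z * \<phi> (a i) * Y)"
      using mat_trace_mult_comm[of "Z * \<phi> (a i) * Y" n n "\<phi> (b i)"] Y Z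
      by (simp add: mat_mult_assoc mult_carrier_mat[of _ n n _ n])
  qed
  also have "\<dots> = mat_trace (mat_sum n n (\<lambda>i. \<phi> (b i) * Z * \<phi> (a i) * Y) {..<N})"
    using Y Z by (intro mat_trace_mat_sum[symmetric] carrier_matI) auto
  also have "\<dots> = mat_trace (flipped_rep_sandwich \<phi> Z * Y)"
    using Z by (simp add: flipped_rep_sandwich_def mat_sum_mult[OF Y summand[OF Z]])
  finally show ?thesis .
qed

definition swap_coefficient :: "nat \<Rightarrow> ('a \<Rightarrow> 'k alg_closure mat) \<Rightarrow> 'k alg_closure \<Rightarrow> bool" where
  "swap_coefficient n \<phi> t \<longleftrightarrow>
    (\<forall>Y\<in>carrier_mat n n. rep_sandwich \<phi> \<phi> Y = (t * mat_trace Y) \<cdot>\<^sub>m 1\<^sub>m n)"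

text \<open>By Schur's lemma both sandwiches are scalar matrices, and the trace pairs them.\<close>

lemma swap_coefficient_exists:
  assumes "irrep s n \<phi>"
  shows "\<exists>t. swap_coefficient n \<phi> t"
proof -
  interpret irrep s n \<phi> by fact
  define E where "E = (mat_unit n n 0 0 :: 'k alg_closure mat)"
  have E: "E \<in> carrier_mat n n" by (simp add: E_def)
  have trace_E: "mat_trace E = 1" using dim_pos by (simp add: E_def mat_trace_mat_unit)
  obtain t where t: "flipped_rep_sandwich \<phi> E = t \<cdot>\<^sub>m 1\<^sub>m n"
    using schur[OF flipped_rep_sandwich_carrier[OF E]]
      flipped_rep_sandwich_commute[OF matrix_rep_axioms E] by metis
  have "rep_sandwich \<phi> \<phi> Y = (t * mat_trace Y) \<cdot>\<^sub>m 1\<^sub>m n" if Y: "Y \<in> carrier_mat n n" for Y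
  proof -
    obtain r where r: "rep_sandwich \<phi> \<phi> Y = r \<cdot>\<^sub>m 1\<^sub>m n"
      using schur[OF rep_sandwich_carrier[OF Y]]
        rep_sandwich_outer[OF matrix_rep_axioms matrix_rep_axioms Y] by metis
    have "E * rep_sandwich \<phi> \<phi> Y = r \<cdot>\<^sub>m E"
      using E by (simp add: r mult_smult_distrib[OF E one_carrier_mat])
    then have "r = mat_trace (E * rep_sandwich \<phi> \<phi> Y)"
      by (simp add: mat_trace_smult[OF E] trace_E)
    also have "\<dots> = mat_trace (flipped_rep_sandwich \<phi> E * Y)"
      by (rule mat_trace_mult_rep_sandwich[OF matrix_rep_axioms Y E])
    also have "\<dots> = t * mat_trace Y"
      using Y by (simp add: t mult_smult_assoc_mat[of _ n n _ n] mat_trace_smult[of _ n])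
    finally show ?thesis by (simp add: r)
  qed
  then show ?thesis unfolding swap_coefficient_def by blast
qed

lemma swap_coefficient_entry:
  assumes "matrix_rep s n \<phi>" "swap_coefficient n \<phi> t" and pqru: "p < n" "q < n" "r < n" "u < n"
  shows "(\<Sum>i<N. \<phi> (a i) $$ (p, q) * \<phi> (b i) $$ (r, u)) = (if p = u \<and> q = r then t else 0)"
proof -
  interpret matrix_rep s n \<phi> by fact
  let ?E = "mat_unit n n q r :: 'k alg_closure mat"
  have "(\<Sum>i<N. \<phi> (a i) $$ (p, q) * \<phi> (b i) $$ (r, u)) = rep_sandwich \<phi> \<phi> ?E $$ (p, u)"
    unfolding rep_sandwich_def using pqru
    by (simp add: mult_mat_unit_mult_index[of _ n n _ n n] carrier_matD[OF mat_unit_carrier]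
        del: index_mult_mat)
  also have "\<dots> = (if p = u \<and> q = r then t else 0)"
    using assms(2) pqru by (simp add: swap_coefficient_def mat_trace_mat_unit)
  finally show ?thesis .
qed

lemma swap_coefficient_trace:
  assumes "irrep s n \<phi>" "swap_coefficient n \<phi> t"
  shows "to_ac (\<tau> x) = t * mat_trace (\<phi> x)"
proof -
  interpret irrep s n \<phi> by fact
  have "to_ac (\<tau> x) \<cdot>\<^sub>m 1\<^sub>m n = \<phi> (\<Sum>i<N. a i * x * b i)"
    by (simp add: sandwich_eq_\<tau> rep_scale rep_one)
  also have "\<dots> = rep_sandwich \<phi> \<phi> (\<phi> x)" by (simp add: rep_sandwich_def rep_sum rep_mult)
  also have "\<dots> = (t * mat_trace (\<phi> x)) \<cdot>\<^sub>m 1\<^sub>m n" using assms(2) by (simp add: swap_coefficient_def)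
  finally have scalar_eq: "to_ac (\<tau> x) \<cdot>\<^sub>m 1\<^sub>m n = (t * mat_trace (\<phi> x)) \<cdot>\<^sub>m 1\<^sub>m n" .
  show ?thesis using arg_cong[OF scalar_eq, of "\<lambda>A. A $$ (0, 0)"] dim_pos by simp
qed

lemma swap_coefficient_nonzero: "irrep s n \<phi> \<Longrightarrow> swap_coefficient n \<phi> t \<Longrightarrow> t \<noteq> 0"
  using \<tau>_nonzero swap_coefficient_trace by fastforce

lemma intertwiner_exists:
  assumes "irrep s n \<phi>" "irrep s m \<psi>"
  obtains Y where "Y \<in> carrier_mat n m" "rep_sandwich \<phi> \<psi> Y \<noteq> 0\<^sub>m n m"
proof -
  interpret \<phi>: irrep s n \<phi> by fact
  interpret \<psi>: irrep s m \<psi> by fact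
  obtain t where t: "swap_coefficient n \<phi> t" using swap_coefficient_exists[OF assms(1)] by blast
  have "1 = \<psi> (\<Sum>i<N. s (\<tau> (a i)) (b i)) $$ (0, 0)"
    using \<tau>_dual[of 1] \<psi>.dim_pos by (simp add: \<psi>.rep_one)
  also have "\<dots> = (\<Sum>i<N. t * mat_trace (\<phi> (a i)) * \<psi> (b i) $$ (0, 0))"
    using \<psi>.dim_pos by (simp add: \<psi>.rep_sum \<psi>.rep_scale swap_coefficient_trace[OF assms(1) t])
  also have "\<dots> = t * (\<Sum>k<n. \<Sum>i<N. \<phi> (a i) $$ (k, k) * \<psi> (b i) $$ (0, 0))"
    by (subst sum.swap) (simp add: mat_trace_def sum_distrib_left sum_distrib_right mult.assoc)
  also have "\<dots> = t * (\<Sum>k<n. rep_sandwich \<phi> \<psi> (mat_unit n m k 0) $$ (k, 0))"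
    using \<psi>.dim_pos by (simp add: rep_sandwich_def mult_mat_unit_mult_index[of _ n n _ m m]
        carrier_matD[OF mat_unit_carrier] del: index_mult_mat)
  finally obtain k where "k < n" "rep_sandwich \<phi> \<psi> (mat_unit n m k 0) $$ (k, 0) \<noteq> 0"
    by (metis (no_types, lifting) lessThan_iff mult_zero_right sum.neutral zero_neq_one)
  then have "rep_sandwich \<phi> \<psi> (mat_unit n m k 0) \<noteq> 0\<^sub>m n m" using \<psi>.dim_pos by auto
  then show ?thesis by (rule that[OF mat_unit_carrier])
qed

lemma intertwiner_left_inverse:
  assumes "irrep s n \<phi>" "irrep s m \<psi>" and Q: "Q \<in> carrier_mat n m" "Q \<noteq> 0\<^sub>m n m"
    and intertwines: "\<And>x. \<phi> x * Q = Q * \<psi> x"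
  obtains P where "P \<in> carrier_mat m n" "P * Q = 1\<^sub>m m" "\<And>x. \<psi> x * P = P * \<phi> x"
proof -
  interpret \<phi>: irrep s n \<phi> by fact
  interpret \<psi>: irrep s m \<psi> by fact
  obtain t where t: "swap_coefficient m \<psi> t" using swap_coefficient_exists[OF assms(2)] by blast
  obtain k l where kl: "k < n" "l < m" "Q $$ (k, l) \<noteq> 0"
    using Q by (metis carrier_matD eq_matI index_zero_mat)
  define Z where "Z = inverse (t * Q $$ (k, l)) \<cdot>\<^sub>m mat_unit m n l k"
  have Z: "Z \<in> carrier_mat m n" by (simp add: Z_def)
  have "mat_trace (mat_unit m n l k * Q) = Q $$ (k, l)"
    using kl Q by (simp add: mat_trace_def mat_unit_mult_index[OF Q(1)]
        carrier_matD[OF mat_unit_carrier] del: index_mult_mat(1))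
  then have "mat_trace (Z * Q) = inverse t"
    using kl Q mult_carrier_mat[OF mat_unit_carrier Q(1), of m l k]
    by (simp add: Z_def mult_smult_assoc_mat[of _ m n _ m] mat_trace_smult[of _ m])
  then have "rep_sandwich \<psi> \<psi> (Z * Q) = 1\<^sub>m m"
    using t swap_coefficient_nonzero[OF assms(2) t] mult_carrier_mat[OF Z Q(1)]
    by (simp add: swap_coefficient_def one_smult_mat)
  moreover have "rep_sandwich \<psi> \<phi> Z * Q = rep_sandwich \<psi> \<psi> (Z * Q)"
  proof -
    have "\<psi> x * Z * \<phi> y \<in> carrier_mat m n" for x y using Z by (intro carrier_matI) auto
    moreover have "\<psi> x * Z * \<phi> y * Q = \<psi> x * (Z * Q) * \<psi> y" for x y
    proof -
      have "\<psi> x * Z * \<phi> y * Q = \<psi> x * Z * (\<phi> y * Q)" using Z Q by (intro mat_mult_assoc) auto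
      also have "\<dots> = \<psi> x * (Z * Q) * \<psi> y"
        unfolding intertwines using Z Q by (simp add: mat_mult_assoc)
      finally show ?thesis .
    qed
    ultimately show ?thesis
      using Q Z unfolding rep_sandwich_def by (simp add: mat_sum_mult[OF Q(1)])
  qed
  ultimately show ?thesis
    using that[OF rep_sandwich_carrier[OF Z]]
      rep_sandwich_outer[OF \<psi>.matrix_rep_axioms \<phi>.matrix_rep_axioms Z] by simp
qed

lemma skolem_noether:
  assumes \<phi>: "irrep s n \<phi>" and \<psi>: "irrep s m \<psi>"
  obtains P Q where "P \<in> carrier_mat m n" "Q \<in> carrier_mat n m" "P * Q = 1\<^sub>m m" "Q * P = 1\<^sub>m n"
    "\<And>x. \<phi> x * Q = Q * \<psi> x"
proof -
  interpret \<phi>: irrep s n \<phi> by fact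
  interpret \<psi>: irrep s m \<psi> by fact
  obtain Y where Y: "Y \<in> carrier_mat n m" "rep_sandwich \<phi> \<psi> Y \<noteq> 0\<^sub>m n m"
    by (rule intertwiner_exists[OF \<phi> \<psi>])
  let ?Q = "rep_sandwich \<phi> \<psi> Y"
  have Q: "?Q \<in> carrier_mat n m" "\<And>x. \<phi> x * ?Q = ?Q * \<psi> x"
    using rep_sandwich_outer[OF \<phi>.matrix_rep_axioms \<psi>.matrix_rep_axioms Y(1)] Y(1) by simp_all
  obtain P where P: "P \<in> carrier_mat m n" "P * ?Q = 1\<^sub>m m" "\<And>x. \<psi> x * P = P * \<phi> x"
    by (rule intertwiner_left_inverse[OF \<phi> \<psi> Q(1) Y(2) Q(2)]) (rule that)
  have "P \<noteq> 0\<^sub>m m n"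
  proof
    assume "P = 0\<^sub>m m n"
    then have "1\<^sub>m m = (0\<^sub>m m m :: 'k alg_closure mat)" using P(2) Q(1) by simp
    from arg_cong[OF this, of "\<lambda>A. A $$ (0, 0)"] show False using \<psi>.dim_pos by simp
  qed
  then obtain R where R: "R \<in> carrier_mat n m" "R * P = 1\<^sub>m n"
    by (rule intertwiner_left_inverse[OF \<psi> \<phi> P(1) _ P(3)])
  have "?Q = R * P * ?Q" using Q(1) by (simp add: R(2))
  also have "\<dots> = R * (P * ?Q)" using R(1) P(1) Q(1) by (intro mat_mult_assoc) auto
  also have "\<dots> = R" using R(1) by (simp add: P(2))
  finally have "?Q * P = 1\<^sub>m n" using R(2) by simp
  then show ?thesis by (rule that[OF P(1) Q(1) P(2) _ Q(2)])
qed

lemma mat_trace_irrep_unique: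
  assumes "irrep s n \<phi>" "irrep s m \<psi>"
  shows "mat_trace (\<phi> x) = mat_trace (\<psi> x)"
proof -
  interpret \<phi>: irrep s n \<phi> by fact
  interpret \<psi>: irrep s m \<psi> by fact
  obtain P Q where PQ: "P \<in> carrier_mat m n" "Q \<in> carrier_mat n m" "P * Q = 1\<^sub>m m" "Q * P = 1\<^sub>m n"
    "\<And>x. \<phi> x * Q = Q * \<psi> x"
    by (rule skolem_noether[OF assms]) blast
  have "mat_trace (\<phi> x) = mat_trace (\<phi> x * (Q * P))" by (simp add: PQ(4))
  also have "\<dots> = mat_trace (\<phi> x * Q * P)" using PQ(1,2) by (simp add: mat_mult_assoc)
  also have "\<dots> = mat_trace (P * (\<phi> x * Q))"
    using PQ(1,2) by (intro mat_trace_mult_comm) auto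
  also have "\<dots> = mat_trace (\<psi> x)" using PQ by (simp add: mat_mult_assoc[symmetric])
  finally show ?thesis .
qed

end


section \<open>Irreducible representations and splittings\<close>

abbreviation ac_scale :: "'k::field \<Rightarrow> 'k alg_closure \<Rightarrow> 'k alg_closure" where
  "ac_scale k l \<equiv> to_ac k * l"

definition extend_scalars ::
  "nat \<Rightarrow> ('a::ring_1 \<Rightarrow> 'k::field alg_closure mat) \<Rightarrow> ('a \<times> 'k alg_closure \<Rightarrow>\<^sub>0 int) \<Rightarrow>
    'k alg_closure mat" where
  "extend_scalars n \<phi> f = mat n n (\<lambda>ij. frag_eval (\<lambda>(x, l). l * \<phi> x $$ ij) f)"

lemma extend_scalars_simps [simp]:
  shows extend_scalars_carrier: "extend_scalars n \<phi> f \<in> carrier_mat n n"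
    and dim_extend_scalars:
      "dim_row (extend_scalars n \<phi> f) = n" "dim_col (extend_scalars n \<phi> f) = n"
    and index_extend_scalars: "i < n \<Longrightarrow> j < n \<Longrightarrow>
      extend_scalars n \<phi> f $$ (i, j) = frag_eval (\<lambda>(x, l). l * \<phi> x $$ (i, j)) f"
  by (simp_all add: extend_scalars_def)

lemma extend_scalars_eq_iff:
  "extend_scalars n \<phi> f = extend_scalars n \<phi> g \<longleftrightarrow> extend_scalars n \<phi> (f - g) = 0\<^sub>m n n"
  by (auto simp: mat_eq_iff frag_eval_diff)

context matrix_rep
begin

lemma extension_coset:
  "mat n n (\<lambda>(i, j). tensor_lift (\<lambda>(x, l). l * \<phi> x $$ (i, j)) (f +o vtensor_ker s ac_scale)) =
    extend_scalars n \<phi> f" (is "?M = _")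
proof (rule eq_matI)
  fix i j assume "i < dim_row (extend_scalars n \<phi> f)" "j < dim_col (extend_scalars n \<phi> f)"
  then have ij: "i < n" "j < n" by simp_all
  have "frag_eval (\<lambda>(x, l). l * \<phi> x $$ (i, j)) d = 0" if "d \<in> vtensor_ker s ac_scale" for d
    using that unfolding vtensor_ker_def
    by (rule tensor_ker_vanish)
      (simp_all add: rep_add_index[OF ij] rep_scale_index[OF ij] algebra_simps)
  then show "?M $$ (i, j) = extend_scalars n \<phi> f $$ (i, j)"
    using ij by (simp add: tensor_lift_coset[OF vtensor_ker.add_subgroup_axioms])
qed simp_all

lemma splitting_iff:
  "splitting s n \<phi> \<longleftrightarrow>
    (\<forall>f. extend_scalars n \<phi> f = 0\<^sub>m n n \<longrightarrow> f \<in> vtensor_ker s ac_scale) \<and>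
    (\<forall>Y\<in>carrier_mat n n. \<exists>f. extend_scalars n \<phi> f = Y)" (is "_ \<longleftrightarrow> ?injective \<and> ?surjective")
proof -
  let ?ext = "\<lambda>z. mat n n (\<lambda>(i, j). tensor_lift (\<lambda>(x, l). l * \<phi> x $$ (i, j)) z)"
  let ?cosets = "range (\<lambda>f. f +o vtensor_ker s ac_scale)"
  have "inj_on ?ext ?cosets \<longleftrightarrow> (\<forall>f g. extend_scalars n \<phi> f = extend_scalars n \<phi> g \<longrightarrow>
      f +o vtensor_ker s ac_scale = g +o vtensor_ker s ac_scale)"
    unfolding inj_on_def by (simp add: extension_coset)
  also have "\<dots> \<longleftrightarrow> ?injective"
    unfolding vtensor_ker.coset_eq_iff extend_scalars_eq_iff by (metis diff_zero)
  finally have "inj_on ?ext ?cosets \<longleftrightarrow> ?injective" .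
  moreover have "?ext ` ?cosets = carrier_mat n n \<longleftrightarrow> ?surjective"
    unfolding image_image extension_coset set_eq_iff image_iff
    by (metis UNIV_I extend_scalars_carrier)
  ultimately show ?thesis
    unfolding splitting_def bij_betw_def vtensor_eq_range
    by (simp add: rep_one rep_mult rep_add rep_scale)
qed

end

lemma splitting_imp_matrix_rep: "splitting s n \<phi> \<Longrightarrow> matrix_rep s n \<phi>"
  by unfold_locales (simp_all add: splitting_def)

lemma (in matrix_rep) commute_extend_scalars:
  assumes C: "C \<in> carrier_mat n n" and comm: "\<And>x. C * \<phi> x = \<phi> x * C"
  shows "C * extend_scalars n \<phi> f = extend_scalars n \<phi> f * C"
proof (rule eq_matI)
  fix i j
  assume "i < dim_row (extend_scalars n \<phi> f * C)" "j < dim_col (extend_scalars n \<phi> f * C)"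
  then have ij: "i < n" "j < n" using C by auto
  have "(C * extend_scalars n \<phi> f) $$ (i, j) = frag_eval (\<lambda>(x, l). l * (C * \<phi> x) $$ (i, j)) f"
    unfolding mult_mat_index[OF C extend_scalars_carrier ij]
      mult_mat_index[OF C rep_carrier ij]
    using ij by (simp add: frag_eval_mult_left[symmetric] frag_eval_sum[symmetric] sum_distrib_left
        case_prod_unfold mult.left_commute)
  also have "\<dots> = (extend_scalars n \<phi> f * C) $$ (i, j)"
    unfolding comm mult_mat_index[OF extend_scalars_carrier C ij]
      mult_mat_index[OF rep_carrier C ij]
    using ij by (simp add: frag_eval_mult_right[symmetric] frag_eval_sum[symmetric] sum_distrib_left
        case_prod_unfold mult.assoc)
  finally show "(C * extend_scalars n \<phi> f) $$ (i, j) = (extend_scalars n \<phi> f * C) $$ (i, j)" .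
qed (use C in auto)

lemma (in azumaya) one_tensor_one_nonzero: "frag_of (1, 1) \<notin> vtensor_ker s ac_scale"
proof
  assume one: "frag_of (1, 1) \<in> vtensor_ker s ac_scale"
  obtain \<theta> :: "'a \<Rightarrow> 'k" where \<theta>: "\<And>x y. \<theta> (x + y) = \<theta> x + \<theta> y"
    "\<And>k x. \<theta> (s k x) = k * \<theta> x" "\<theta> 1 = 1"
    by (rule linear_form_exists[of 1]) auto
  have "frag_eval (\<lambda>(x, l). to_ac (\<theta> x) * l) (frag_of (1, 1)) = 0"
    using one unfolding vtensor_ker_def by (rule tensor_ker_vanish) (auto simp: \<theta> algebra_simps)
  then show False by (simp add: \<theta>(3))
qed

lemma (in azumaya) splitting_imp_irrep:
  assumes "splitting s n \<phi>"
  shows "irrep s n \<phi>"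
proof -
  interpret matrix_rep s n \<phi> using assms by (rule splitting_imp_matrix_rep)
  have surjective: "\<exists>f. extend_scalars n \<phi> f = Y" if "Y \<in> carrier_mat n n" for Y
    using assms that unfolding splitting_iff by blast
  show ?thesis
  proof
    show "0 < n"
    proof (rule ccontr)
      assume "\<not> 0 < n"
      then have "extend_scalars n \<phi> (frag_of (1, 1)) = 0\<^sub>m n n" by (intro eq_matI) auto
      then have "frag_of (1, 1) \<in> vtensor_ker s ac_scale"
        using assms unfolding splitting_iff by blast
      with one_tensor_one_nonzero show False by contradiction
    qed
    fix C assume C: "C \<in> carrier_mat n n" and comm: "\<And>x. C * \<phi> x = \<phi> x * C"
    have "C * Y = Y * C" if "Y \<in> carrier_mat n n" for Y
      using surjective[OF that] commute_extend_scalars[OF C comm] by metis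
    then show "\<exists>t. C = t \<cdot>\<^sub>m 1\<^sub>m n" by (rule commuting_imp_scalar_mat[OF C])
  qed
qed

context swap_tensor
begin

text \<open>Expanding \<open>x\<close> in the dual system \<open>a\<^sub>i, b\<^sub>i\<close> normalizes a tensor \<open>\<Sum> x \<otimes> l\<close> of \<open>A \<otimes> L\<close>.\<close>

lemma vtensor_dual_expansion:
  fixes f :: "'a \<times> 'k alg_closure \<Rightarrow>\<^sub>0 int"
  defines "coord \<equiv> \<lambda>i. frag_eval (\<lambda>(x, l). to_ac (\<tau> (a i * x)) * l)"
  shows "f - (\<Sum>i<N. frag_of (b i, coord i f)) \<in> vtensor_ker s ac_scale"
proof (rule frag_induction[where S = UNIV and c = f])
  show "0 - (\<Sum>i<N. frag_of (b i, coord i 0)) \<in> vtensor_ker s ac_scale"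
    by (intro vtensor_ker.diff_mem vtensor_ker.zero_mem vtensor_ker.sum_mem)
      (simp add: coord_def vtensor_ker_zero_right)
next
  fix p :: "'a \<times> 'k alg_closure"
  obtain x l where p: "p = (x, l)" by fastforce
  have "(frag_of (\<Sum>i<N. s (\<tau> (a i * x)) (b i), l) - (\<Sum>i<N. frag_of (s (\<tau> (a i * x)) (b i), l))) +
      (\<Sum>i<N. frag_of (s (\<tau> (a i * x)) (b i), l) - frag_of (b i, ac_scale (\<tau> (a i * x)) l))
      \<in> vtensor_ker s ac_scale"
    by (intro vtensor_ker.add_mem vtensor_ker_sum_left vtensor_ker.sum_mem vtensor_ker_scale) simp
  then show "frag_of p - (\<Sum>i<N. frag_of (b i, coord i (frag_of p))) \<in> vtensor_ker s ac_scale"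
    by (simp add: p coord_def \<tau>_dual sum_subtractf)
next
  fix f g :: "'a \<times> 'k alg_closure \<Rightarrow>\<^sub>0 int"
  assume f: "f - (\<Sum>i<N. frag_of (b i, coord i f)) \<in> vtensor_ker s ac_scale"
    and g: "g - (\<Sum>i<N. frag_of (b i, coord i g)) \<in> vtensor_ker s ac_scale"
  have "(\<Sum>i<N. frag_of (b i, coord i f) - frag_of (b i, coord i g) -
      frag_of (b i, coord i f - coord i g)) \<in> vtensor_ker s ac_scale"
    by (intro vtensor_ker.sum_mem vtensor_ker_diff_right)
  from vtensor_ker.add_mem[OF vtensor_ker.diff_mem[OF f g] this]
  show "f - g - (\<Sum>i<N. frag_of (b i, coord i (f - g))) \<in> vtensor_ker s ac_scale"
    by (simp add: coord_def frag_eval_diff sum_subtractf)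
qed simp

lemma swap_coefficient_contraction:
  assumes "matrix_rep s n \<phi>" "swap_coefficient n \<phi> t"
    and "\<And>x. x \<in> I \<Longrightarrow> p x < n" "\<And>x. x \<in> I \<Longrightarrow> q x < n"
    and "\<And>x. x \<in> I \<Longrightarrow> r x < n" "\<And>x. x \<in> I \<Longrightarrow> u x < n"
  shows "(\<Sum>i<N. \<Sum>x\<in>I. c x * (\<phi> (a i) $$ (p x, q x) * \<phi> (b i) $$ (r x, u x))) =
    (\<Sum>x\<in>I. if p x = u x \<and> q x = r x then c x * t else 0)"
proof -
  have "(\<Sum>i<N. \<Sum>x\<in>I. c x * (\<phi> (a i) $$ (p x, q x) * \<phi> (b i) $$ (r x, u x))) =
      (\<Sum>x\<in>I. c x * (\<Sum>i<N. \<phi> (a i) $$ (p x, q x) * \<phi> (b i) $$ (r x, u x)))"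
    by (subst sum.swap) (simp add: sum_distrib_left)
  also have "\<dots> = (\<Sum>x\<in>I. if p x = u x \<and> q x = r x then c x * t else 0)"
    by (intro sum.cong) (simp_all add: swap_coefficient_entry[OF assms(1,2)] assms(3-))
  finally show ?thesis .
qed

lemma swap_coefficient_dual:
  assumes "matrix_rep s n \<phi>" "swap_coefficient n \<phi> t"
    and Y: "Y \<in> carrier_mat n n" and ru: "r < n" "u < n"
  shows "(\<Sum>i<N. mat_trace (Y * \<phi> (a i)) * \<phi> (b i) $$ (r, u)) = t * Y $$ (r, u)"
proof -
  interpret matrix_rep s n \<phi> by fact
  have trace: "mat_trace (Y * \<phi> x) = (\<Sum>(q, p)\<in>{..<n} \<times> {..<n}. Y $$ (q, p) * \<phi> x $$ (p, q))" for x
    unfolding mat_trace_def sum.cartesian_product[symmetric] using Y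
    by (intro sum.cong) (auto simp: mult_mat_index[OF Y rep_carrier] simp del: index_mult_mat(1))
  have "(\<Sum>i<N. mat_trace (Y * \<phi> (a i)) * \<phi> (b i) $$ (r, u)) =
      (\<Sum>i<N. \<Sum>x\<in>{..<n} \<times> {..<n}. Y $$ x * (\<phi> (a i) $$ (snd x, fst x) * \<phi> (b i) $$ (r, u)))"
    by (simp add: trace sum_distrib_right mult.assoc case_prod_unfold)
  also have "\<dots> = (\<Sum>x\<in>{..<n} \<times> {..<n}. if snd x = u \<and> fst x = r then Y $$ x * t else 0)"
    by (rule swap_coefficient_contraction[OF assms(1,2)]) (use ru in auto)
  also have "\<dots> = (\<Sum>x\<in>{..<n} \<times> {..<n}. if x = (r, u) then Y $$ x * t else 0)"
    by (intro sum.cong) auto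
  also have "\<dots> = t * Y $$ (r, u)" using ru by simp
  finally show ?thesis .
qed

lemma irrep_imp_splitting:
  assumes \<phi>: "irrep s n \<phi>"
  shows "splitting s n \<phi>"
proof -
  interpret irrep s n \<phi> by fact
  obtain t where t: "swap_coefficient n \<phi> t" using swap_coefficient_exists[OF \<phi>] by blast
  have "t \<noteq> 0" by (rule swap_coefficient_nonzero[OF \<phi> t])
  have "f \<in> vtensor_ker s ac_scale" if "extend_scalars n \<phi> f = 0\<^sub>m n n" for f
  proof -
    have entry: "frag_eval (\<lambda>(x, l). l * \<phi> x $$ (q, p)) f = 0" if "q < n" "p < n" for p q
      using arg_cong[OF \<open>extend_scalars n \<phi> f = 0\<^sub>m n n\<close>, of "\<lambda>A. A $$ (q, p)"] that by simp
    have "frag_eval (\<lambda>(x, l). to_ac (\<tau> (a i * x)) * l) f = 0" for i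
    proof -
      have "frag_eval (\<lambda>(x, l). to_ac (\<tau> (a i * x)) * l) f =
          frag_eval (\<lambda>(x, l). \<Sum>p<n. \<Sum>q<n. t * \<phi> (a i) $$ (p, q) * (l * \<phi> x $$ (q, p))) f"
        by (intro frag_eval_cong)
          (auto simp: swap_coefficient_trace[OF \<phi> t] rep_mult mat_trace_def
            mult_mat_index[OF rep_carrier rep_carrier] sum_distrib_left mult_ac
            simp del: index_mult_mat(1))
      also have "\<dots> = (\<Sum>p<n. \<Sum>q<n. t * \<phi> (a i) $$ (p, q) * frag_eval (\<lambda>(x, l). l * \<phi> x $$ (q, p)) f)"
        by (simp add: case_prod_unfold frag_eval_sum frag_eval_mult_left)
      also have "\<dots> = 0" by (simp add: entry)
      finally show ?thesis .
    qed
    then have "(\<Sum>i<N. frag_of (b i, frag_eval (\<lambda>(x, l). to_ac (\<tau> (a i * x)) * l) f))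
        \<in> vtensor_ker s ac_scale"
      by (intro vtensor_ker.sum_mem) (simp add: vtensor_ker_zero_right)
    from vtensor_ker.add_mem[OF vtensor_dual_expansion[of f] this] show ?thesis by simp
  qed
  moreover have "\<exists>f. extend_scalars n \<phi> f = Y" if Y: "Y \<in> carrier_mat n n" for Y
  proof (rule exI, rule eq_matI)
    let ?f = "\<Sum>i<N. frag_of (b i, mat_trace (Y * \<phi> (a i)) / t)"
    fix r u assume "r < dim_row Y" "u < dim_col Y"
    then have ru: "r < n" "u < n" using Y by auto
    then show "extend_scalars n \<phi> ?f $$ (r, u) = Y $$ (r, u)"
      using swap_coefficient_dual[OF matrix_rep_axioms t Y ru] \<open>t \<noteq> 0\<close>
      by (simp add: frag_eval_of_sum sum_divide_distrib[symmetric])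
  qed (use Y in simp_all)
  ultimately show ?thesis unfolding splitting_iff by blast
qed

end


section \<open>Adjoint bilinear forms and the sign of the involution\<close>

lemma alg_closure_eq_neg_iff:
  fixes x :: "'k::field alg_closure"
  assumes "(2 :: 'k) \<noteq> 0"
  shows "x = - x \<longleftrightarrow> x = 0"
proof
  assume "x = - x"
  then have "2 * x = 0" by (metis add.right_inverse mult_2)
  moreover have "(2 :: 'k alg_closure) \<noteq> 0" using assms by (metis to_ac_eq_0_iff to_ac_numeral)
  ultimately show "x = 0" by simp
qed simp

lemma (in azumaya_involution) irrep_transpose:
  assumes "irrep s n \<phi>"
  shows "irrep s n (\<lambda>x. transpose_mat (\<phi> (\<sigma> x)))"
proof -
  interpret irrep s n \<phi> by fact
  show ?thesis
  proof
    fix C assume C: "C \<in> carrier_mat n n"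
      and comm: "\<And>x. C * transpose_mat (\<phi> (\<sigma> x)) = transpose_mat (\<phi> (\<sigma> x)) * C"
    have "transpose_mat C * \<phi> x = \<phi> x * transpose_mat C" for x
    proof -
      have "transpose_mat C * \<phi> x = transpose_mat (transpose_mat (\<phi> x) * C)"
        using C by (simp add: transpose_mult[of _ n n _ n])
      also have "\<dots> = transpose_mat (C * transpose_mat (\<phi> x))" using comm[of "\<sigma> x"] by simp
      also have "\<dots> = \<phi> x * transpose_mat C" using C by (simp add: transpose_mult[of _ n n _ n])
      finally show ?thesis .
    qed
    then obtain t where t: "transpose_mat C = t \<cdot>\<^sub>m 1\<^sub>m n" using schur[of "transpose_mat C"] C by auto
    have "C = transpose_mat (t \<cdot>\<^sub>m 1\<^sub>m n)" unfolding t[symmetric] by simp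
    also have "\<dots> = t \<cdot>\<^sub>m 1\<^sub>m n" by (rule eq_matI) auto
    finally show "\<exists>t. C = t \<cdot>\<^sub>m 1\<^sub>m n" ..
  qed (auto simp: dim_pos rep_one \<sigma>_mult rep_mult transpose_mult[OF rep_carrier rep_carrier]
      \<sigma>_add rep_add \<sigma>_scale rep_scale)
qed

context swap_tensor
begin

lemma adjoint_exists:
  assumes \<phi>: "irrep s n \<phi>"
  shows "\<exists>G. adjoint_to s \<sigma> n \<phi> G"
proof -
  obtain P Q where PQ: "P \<in> carrier_mat n n" "Q \<in> carrier_mat n n" "P * Q = 1\<^sub>m n" "Q * P = 1\<^sub>m n"
    and intertwines: "\<And>x. transpose_mat (\<phi> (\<sigma> x)) * Q = Q * \<phi> x"
    by (rule skolem_noether[OF irrep_transpose[OF \<phi>] \<phi>]) blast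
  have "invertible_mat Q" using PQ unfolding invertible_mat_def inverts_mat_def by auto
  moreover have "transpose_mat (\<phi> x) * Q = Q * \<phi> (\<sigma> x)" for x using intertwines[of "\<sigma> x"] by simp
  ultimately show ?thesis
    unfolding adjoint_to_def using irrep_imp_splitting[OF \<phi>] PQ(2) by blast
qed

lemma adjoint_imp_irrep: "adjoint_to s \<sigma> n \<phi> G \<Longrightarrow> irrep s n \<phi>"
  by (simp add: adjoint_to_def splitting_imp_irrep)

lemma swap_coefficient_transpose:
  assumes "matrix_rep s n \<phi>" "swap_coefficient n \<phi> t" and Y: "Y \<in> carrier_mat n n"
  shows "mat_sum n n (\<lambda>i. \<phi> (a i) * Y * transpose_mat (\<phi> (b i))) {..<N} = t \<cdot>\<^sub>m transpose_mat Y"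
proof (rule eq_matI)
  interpret matrix_rep s n \<phi> by fact
  fix p r assume "p < dim_row (t \<cdot>\<^sub>m transpose_mat Y)" "r < dim_col (t \<cdot>\<^sub>m transpose_mat Y)"
  then have pr: "p < n" "r < n" using Y by auto
  have entry: "(\<phi> x * Y * transpose_mat (\<phi> y)) $$ (p, r) =
      (\<Sum>q<n. \<Sum>u<n. Y $$ (q, u) * (\<phi> x $$ (p, q) * \<phi> y $$ (r, u)))" for x y
  proof -
    have \<phi>Y: "\<phi> x * Y \<in> carrier_mat n n" and transposed: "transpose_mat (\<phi> y) \<in> carrier_mat n n"
      using Y by (auto intro: carrier_matI)
    have "(\<phi> x * Y * transpose_mat (\<phi> y)) $$ (p, r) = (\<Sum>u<n. (\<phi> x * Y) $$ (p, u) * \<phi> y $$ (r, u))"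
      unfolding mult_mat_index[OF \<phi>Y transposed pr] using pr by (simp del: index_mult_mat(1))
    also have "\<dots> = (\<Sum>u<n. \<Sum>q<n. Y $$ (q, u) * (\<phi> x $$ (p, q) * \<phi> y $$ (r, u)))"
      using pr by (intro sum.cong)
        (simp_all add: mult_mat_index[OF rep_carrier Y] sum_distrib_left sum_distrib_right mult_ac
          del: index_mult_mat(1))
    finally show ?thesis by (subst sum.swap)
  qed
  have "mat_sum n n (\<lambda>i. \<phi> (a i) * Y * transpose_mat (\<phi> (b i))) {..<N} $$ (p, r) =
      (\<Sum>i<N. \<Sum>x\<in>{..<n} \<times> {..<n}. Y $$ x * (\<phi> (a i) $$ (p, fst x) * \<phi> (b i) $$ (r, snd x)))"
    using pr by (simp add: entry sum.cartesian_product case_prod_unfold del: index_mult_mat(1))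
  also have "\<dots> = (\<Sum>x\<in>{..<n} \<times> {..<n}. if p = snd x \<and> fst x = r then Y $$ x * t else 0)"
    by (rule swap_coefficient_contraction[OF assms(1,2)]) (use pr in auto)
  also have "\<dots> = (\<Sum>x\<in>{..<n} \<times> {..<n}. if x = (r, p) then Y $$ x * t else 0)"
    by (intro sum.cong) auto
  also have "\<dots> = (t \<cdot>\<^sub>m transpose_mat Y) $$ (p, r)" using pr Y by simp
  finally show "mat_sum n n (\<lambda>i. \<phi> (a i) * Y * transpose_mat (\<phi> (b i))) {..<N} $$ (p, r) =
      (t \<cdot>\<^sub>m transpose_mat Y) $$ (p, r)" .
qed (use assms(3) in auto)

text \<open>Substitute \<open>\<phi>(\<sigma> b) = G\<^sup>-\<^sup>1 \<phi>(b)\<^sup>T G\<close> in \<open>\<Sum> \<phi>(a\<^sub>i) \<phi>(\<sigma> b\<^sub>i) = \<phi>(\<sigma> 1) = 1\<close>.\<close>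

lemma adjoint_transpose:
  assumes adj: "adjoint_to s \<sigma> n \<phi> G" and t: "swap_coefficient n \<phi> t"
  shows "transpose_mat G = t \<cdot>\<^sub>m G"
proof -
  interpret irrep s n \<phi> by (rule adjoint_imp_irrep[OF adj])
  have G: "G \<in> carrier_mat n n" and adjoint: "\<And>x. transpose_mat (\<phi> x) * G = G * \<phi> (\<sigma> x)"
    using adj by (auto simp: adjoint_to_def)
  obtain H where H: "H \<in> carrier_mat n n" "H * G = 1\<^sub>m n"
    using adj by (auto simp: adjoint_to_def elim: invertible_mat_imp_inverse)
  have \<phi>\<sigma>: "\<phi> (\<sigma> x) = H * (transpose_mat (\<phi> x) * G)" for x
  proof -
    have "\<phi> (\<sigma> x) = H * G * \<phi> (\<sigma> x)" by (simp add: H)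
    then show ?thesis using H(1) G by (simp add: mat_mult_assoc adjoint)
  qed
  let ?S = "\<lambda>i. \<phi> (a i) * H * transpose_mat (\<phi> (b i))"
  have summand: "?S i \<in> carrier_mat n n" for i using H(1) by (intro carrier_matI) auto
  have "1\<^sub>m n = \<phi> (\<Sum>i<N. a i * 1 * \<sigma> (b i))" by (simp only: twisted_sandwich \<sigma>_one rep_one)
  also have "\<dots> = mat_sum n n (\<lambda>i. ?S i * G) {..<N}"
    using H(1) G by (simp add: rep_sum rep_mult \<phi>\<sigma> mat_mult_assoc)
  also have "\<dots> = t \<cdot>\<^sub>m transpose_mat H * G"
    by (simp only: mat_sum_mult[OF G, of "{..<N}" ?S n, OF summand, symmetric]
        swap_coefficient_transpose[OF matrix_rep_axioms t H(1)])
  finally have one: "1\<^sub>m n = t \<cdot>\<^sub>m transpose_mat H * G" .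
  have "transpose_mat G * transpose_mat H = 1\<^sub>m n"
    using transpose_mult[OF H(1) G] H(2) by simp
  then have "t \<cdot>\<^sub>m G = transpose_mat G * transpose_mat H * (t \<cdot>\<^sub>m G)" using G by simp
  also have "\<dots> = transpose_mat G * (t \<cdot>\<^sub>m transpose_mat H * G)"
    using G H(1) by (simp add: mat_mult_assoc mult_smult_distrib[of _ n n _ n]
        mult_smult_assoc_mat[of _ n n _ n])
  also have "\<dots> = transpose_mat G" using G by (simp add: one[symmetric])
  finally show ?thesis ..
qed

lemma adjoint_nonzero_entry:
  assumes "adjoint_to s \<sigma> n \<phi> G"
  obtains i j where "i < n" "j < n" "G $$ (i, j) \<noteq> 0"
proof -
  interpret irrep s n \<phi> by (rule adjoint_imp_irrep[OF assms])
  have G: "G \<in> carrier_mat n n" and "invertible_mat G" using assms by (auto simp: adjoint_to_def)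
  then obtain H where H: "H \<in> carrier_mat n n" "G * H = 1\<^sub>m n" by (rule invertible_mat_imp_inverse)
  have "G \<noteq> 0\<^sub>m n n"
  proof
    assume "G = 0\<^sub>m n n"
    then have "1\<^sub>m n = (0\<^sub>m n n :: 'k alg_closure mat)" using H by simp
    from arg_cong[OF this, of "\<lambda>A. A $$ (0, 0)"] show False using dim_pos by simp
  qed
  then show ?thesis using that G by (metis carrier_matD eq_matI index_zero_mat)
qed

lemma swap_coefficient_cases:
  assumes \<phi>: "irrep s n \<phi>" and t: "swap_coefficient n \<phi> t"
  shows "t = 1 \<or> t = - 1"
proof -
  obtain G where adj: "adjoint_to s \<sigma> n \<phi> G" using adjoint_exists[OF \<phi>] by blast
  then have G: "G \<in> carrier_mat n n" by (simp add: adjoint_to_def)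
  have flip: "G $$ (j, i) = t * G $$ (i, j)" if "i < n" "j < n" for i j
    using arg_cong[OF adjoint_transpose[OF adj t], of "\<lambda>A. A $$ (i, j)"] that G by simp
  obtain i j where ij: "i < n" "j < n" "G $$ (i, j) \<noteq> 0" by (rule adjoint_nonzero_entry[OF adj])
  have "G $$ (i, j) = t * t * G $$ (i, j)" using flip ij(1,2) by (metis mult.assoc)
  then have "t * t = 1" using ij(3) by simp
  then show ?thesis by (simp add: square_eq_1_iff)
qed

lemma swap_coefficient_unique:
  assumes "irrep s n \<phi>" "swap_coefficient n \<phi> t" and "irrep s m \<psi>" "swap_coefficient m \<psi> u"
  shows "t = u"
proof -
  obtain z where "\<tau> z \<noteq> 0" using \<tau>_nonzero by blast
  then have "to_ac (\<tau> z) \<noteq> 0" by simp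
  then show ?thesis
    using swap_coefficient_trace[OF assms(1,2), of z] swap_coefficient_trace[OF assms(3,4), of z]
      mat_trace_irrep_unique[OF assms(1,3), of z] by auto
qed

lemma swap_sign_exists:
  obtains \<delta> :: int where "\<delta> = 1 \<or> \<delta> = - 1" "\<And>n \<phi>. irrep s n \<phi> \<Longrightarrow> swap_coefficient n \<phi> (of_int \<delta>)"
proof -
  obtain n \<phi> where \<phi>: "irrep s n \<phi>" using irrep_exists by blast
  obtain t where t: "swap_coefficient n \<phi> t" using swap_coefficient_exists[OF \<phi>] by blast
  obtain \<delta> :: int where \<delta>: "\<delta> = 1 \<or> \<delta> = - 1" "t = of_int \<delta>"
    using swap_coefficient_cases[OF \<phi> t] by (metis of_int_1 of_int_minus)
  have "swap_coefficient m \<psi> (of_int \<delta>)" if \<psi>: "irrep s m \<psi>" for m \<psi>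
    using swap_coefficient_exists[OF \<psi>] swap_coefficient_unique[OF \<phi> t \<psi>] \<delta>(2) by metis
  with \<delta>(1) show ?thesis by (rule that)
qed

lemma to_ac_Trd:
  assumes \<phi>: "irrep s n \<phi>"
  shows "to_ac (Trd s x) = mat_trace (\<phi> x)"
proof -
  obtain \<delta> :: int where "\<delta> = 1 \<or> \<delta> = - 1" and "swap_coefficient n \<phi> (of_int \<delta>)"
    using swap_sign_exists \<phi> by metis
  then have trace_eq: "mat_trace (\<phi> x) = to_ac (of_int \<delta> * \<tau> x)"
    using swap_coefficient_trace[OF \<phi>, of "of_int \<delta>" x] by auto
  have trace_sum: "mat_trace (\<psi> x) = (\<Sum>i<m. \<psi> x $$ (i, i))" if "splitting s m \<psi>" for m \<psi>
    using that by (auto simp: mat_trace_def splitting_def)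
  have "Trd s x = of_int \<delta> * \<tau> x"
    unfolding Trd_def
  proof (rule the_equality)
    show "\<exists>n \<phi>. splitting s n \<phi> \<and> to_ac (of_int \<delta> * \<tau> x) = (\<Sum>i<n. \<phi> x $$ (i, i))"
      using irrep_imp_splitting[OF \<phi>] trace_sum trace_eq by metis
    fix k assume "\<exists>n \<phi>. splitting s n \<phi> \<and> to_ac k = (\<Sum>i<n. \<phi> x $$ (i, i))"
    then obtain m \<psi> where \<psi>: "splitting s m \<psi>" and "to_ac k = mat_trace (\<psi> x)"
      using trace_sum by metis
    then have "to_ac k = to_ac (of_int \<delta> * \<tau> x)"
      using mat_trace_irrep_unique[OF \<phi> splitting_imp_irrep[OF \<psi>], of x] trace_eq by simp
    then show "k = of_int \<delta> * \<tau> x" by (simp only: to_ac_eq_iff)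
  qed
  then show ?thesis using trace_eq by simp
qed

lemma Trd_add: "Trd s (x + y) = Trd s x + Trd s y"
  and Trd_scale: "Trd s (s k x) = k * Trd s x"
  and Trd_cyclic: "Trd s (x * y) = Trd s (y * x)"
  and Trd_\<sigma>: "Trd s (\<sigma> x) = Trd s x"
proof -
  obtain n \<phi> where \<phi>: "irrep s n \<phi>" using irrep_exists by blast
  interpret irrep s n \<phi> by fact
  have Trd_eqI: "Trd s y = k" if "mat_trace (\<phi> y) = to_ac k" for y k
    using that to_ac_Trd[OF \<phi>, of y] by simp
  show "Trd s (x + y) = Trd s x + Trd s y"
    by (rule Trd_eqI) (simp add: rep_trace_add to_ac_Trd[OF \<phi>])
  show "Trd s (s k x) = k * Trd s x"
    by (rule Trd_eqI) (simp add: rep_trace_scale to_ac_Trd[OF \<phi>])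
  show "Trd s (x * y) = Trd s (y * x)"
    by (rule Trd_eqI) (simp add: rep_trace_mult_comm[of x] to_ac_Trd[OF \<phi>])
  have "mat_trace (\<phi> (\<sigma> x)) = mat_trace (transpose_mat (\<phi> (\<sigma> x)))"
    by (rule mat_trace_transpose[OF rep_carrier, symmetric])
  also have "\<dots> = to_ac (Trd s x)" by (rule to_ac_Trd[OF irrep_transpose[OF \<phi>], symmetric])
  finally show "Trd s (\<sigma> x) = Trd s x" by (rule Trd_eqI)
qed

lemma \<tau>_eq_0_iff: "\<tau> x = 0 \<longleftrightarrow> Trd s x = 0"
proof -
  obtain n \<phi> where \<phi>: "irrep s n \<phi>" using irrep_exists by blast
  obtain t where t: "swap_coefficient n \<phi> t" using swap_coefficient_exists[OF \<phi>] by blast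
  have "to_ac (\<tau> x) = 0 \<longleftrightarrow> to_ac (Trd s x) = 0"
    using swap_coefficient_nonzero[OF \<phi> t]
    by (simp only: swap_coefficient_trace[OF \<phi> t] to_ac_Trd[OF \<phi>] mult_eq_0_iff simp_thms)
  then show ?thesis by simp
qed

abbreviation "\<epsilon> \<equiv> involution_sign s \<sigma>"

lemma orthogonal_involution_iff:
  assumes two: "(2 :: 'k) \<noteq> 0" and \<delta>: "\<delta> = 1 \<or> \<delta> = - 1"
    and coefficient: "\<And>n \<phi>. irrep s n \<phi> \<Longrightarrow> swap_coefficient n \<phi> (of_int \<delta>)"
  shows "orthogonal_involution s \<sigma> \<longleftrightarrow> \<delta> = 1"
proof
  assume "\<delta> = 1"
  obtain n \<phi> G where G: "adjoint_to s \<sigma> n \<phi> G" using irrep_exists adjoint_exists by metis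
  have "transpose_mat G = G"
    using adjoint_transpose[OF G coefficient[OF adjoint_imp_irrep[OF G]]] \<open>\<delta> = 1\<close>
    by (simp add: one_smult_mat)
  then show "orthogonal_involution s \<sigma>" using G unfolding orthogonal_involution_def by blast
next
  assume "orthogonal_involution s \<sigma>"
  then obtain n \<phi> G where G: "adjoint_to s \<sigma> n \<phi> G" and symmetric: "transpose_mat G = G"
    unfolding orthogonal_involution_def by blast
  obtain i j where ij: "i < n" "j < n" "G $$ (i, j) \<noteq> 0" by (rule adjoint_nonzero_entry[OF G])
  have "G = of_int \<delta> \<cdot>\<^sub>m G"
    using adjoint_transpose[OF G coefficient[OF adjoint_imp_irrep[OF G]]] symmetric by simp
  moreover have "G \<in> carrier_mat n n" using G by (simp add: adjoint_to_def)
  ultimately have "G $$ (i, j) = of_int \<delta> * G $$ (i, j)"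
    using ij(1,2) by (metis carrier_matD index_smult_mat(1))
  then have "\<delta> \<noteq> - 1" using ij(3) alg_closure_eq_neg_iff[OF two, of "G $$ (i, j)"] by auto
  then show "\<delta> = 1" using \<delta> by simp
qed

lemma symplectic_involution_iff:
  assumes two: "(2 :: 'k) \<noteq> 0" and \<delta>: "\<delta> = 1 \<or> \<delta> = - 1"
    and coefficient: "\<And>n \<phi>. irrep s n \<phi> \<Longrightarrow> swap_coefficient n \<phi> (of_int \<delta>)"
  shows "symplectic_involution s \<sigma> \<longleftrightarrow> \<delta> = - 1"
proof
  assume "\<delta> = - 1"
  obtain n \<phi> G where G: "adjoint_to s \<sigma> n \<phi> G" using irrep_exists adjoint_exists by metis
  then have car: "G \<in> carrier_mat n n" by (simp add: adjoint_to_def)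
  have skew: "transpose_mat G = - G"
    using adjoint_transpose[OF G coefficient[OF adjoint_imp_irrep[OF G]]] car \<open>\<delta> = - 1\<close>
    by (intro eq_matI) auto
  have "G $$ (i, i) = 0" if "i < n" for i
    using arg_cong[OF skew, of "\<lambda>A. A $$ (i, i)"] car that alg_closure_eq_neg_iff[OF two] by simp
  then show "symplectic_involution s \<sigma>" using G skew unfolding symplectic_involution_def by blast
next
  assume "symplectic_involution s \<sigma>"
  then obtain n \<phi> G where G: "adjoint_to s \<sigma> n \<phi> G" and skew: "transpose_mat G = - G"
    unfolding symplectic_involution_def by blast
  obtain i j where ij: "i < n" "j < n" "G $$ (i, j) \<noteq> 0" by (rule adjoint_nonzero_entry[OF G])
  have "- G = of_int \<delta> \<cdot>\<^sub>m G"
    using adjoint_transpose[OF G coefficient[OF adjoint_imp_irrep[OF G]]] skew by simp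
  moreover have "G \<in> carrier_mat n n" using G by (simp add: adjoint_to_def)
  ultimately have "- G $$ (i, j) = of_int \<delta> * G $$ (i, j)"
    using ij(1,2) by (metis carrier_matD index_smult_mat(1) index_uminus_mat(1))
  then have "\<delta> \<noteq> 1" using ij(3) alg_closure_eq_neg_iff[OF two, of "G $$ (i, j)"] by auto
  then show "\<delta> = - 1" using \<delta> by simp
qed

lemma involution_sign_swap_coefficient:
  assumes "(2 :: 'k) \<noteq> 0"
  shows involution_sign_cases: "\<epsilon> = 1 \<or> \<epsilon> = - 1"
    and involution_sign_coefficient: "irrep s n \<phi> \<Longrightarrow> swap_coefficient n \<phi> (of_int \<epsilon>)"
proof -
  obtain \<delta> :: int where \<delta>: "\<delta> = 1 \<or> \<delta> = - 1"
    "\<And>n \<phi>. irrep s n \<phi> \<Longrightarrow> swap_coefficient n \<phi> (of_int \<delta>)"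
    by (rule swap_sign_exists) (rule that)
  have "orthogonal_involution s \<sigma> \<longleftrightarrow> \<delta> = 1"
    by (rule orthogonal_involution_iff[OF assms \<delta>])
  moreover have "symplectic_involution s \<sigma> \<longleftrightarrow> \<delta> = - 1"
    by (rule symplectic_involution_iff[OF assms \<delta>])
  ultimately have "\<epsilon> = \<delta>" unfolding involution_sign_def using \<delta>(1) by (intro the_equality) auto
  with \<delta> show "\<epsilon> = 1 \<or> \<epsilon> = - 1"
    and "irrep s n \<phi> \<Longrightarrow> swap_coefficient n \<phi> (of_int \<epsilon>)" by simp_all
qed

end


section \<open>The algebra \<open>A \<otimes> A\<close>\<close>

definition frag_mult ::
  "('a::ring_1 \<times> 'a \<Rightarrow>\<^sub>0 int) \<Rightarrow> ('a \<times> 'a \<Rightarrow>\<^sub>0 int) \<Rightarrow> ('a \<times> 'a \<Rightarrow>\<^sub>0 int)" where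
  "frag_mult x y = frag_extend (\<lambda>(a, b). frag_extend (\<lambda>(c, d). frag_of (a * c, b * d)) y) x"

lemma frag_eval_mult:
  "frag_eval h (frag_mult x y) = frag_eval (\<lambda>(a, b). frag_eval (\<lambda>(c, d). h (a * c, b * d)) y) x"
  by (simp add: frag_mult_def frag_eval_extend case_prod_unfold)

lemma frag_mult_add_left: "frag_mult (x + y) z = frag_mult x z + frag_mult y z"
  by (simp add: frag_mult_def frag_extend_add)

lemma frag_mult_add_right: "frag_mult z (x + y) = frag_mult z x + frag_mult z y"
proof -
  have "frag_extend (\<lambda>p. k p + l p) z = frag_extend k z + frag_extend l z"
    for k l :: "_ \<Rightarrow> 'a \<times> 'a \<Rightarrow>\<^sub>0 int"
    by (simp add: frag_extend_def frag_cmul_distrib2 sum.distrib)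
  then show ?thesis
    by (simp add: frag_mult_def frag_extend_add case_prod_unfold)
qed

context azumaya_involution
begin

definition frag_inv :: "('a \<times> 'a \<Rightarrow>\<^sub>0 int) \<Rightarrow> ('a \<times> 'a \<Rightarrow>\<^sub>0 int)" where
  "frag_inv x = frag_extend (\<lambda>(a, b). frag_of (\<sigma> a, \<sigma> b)) x"

lemma frag_eval_inv: "frag_eval h (frag_inv x) = frag_eval (\<lambda>(a, b). h (\<sigma> a, \<sigma> b)) x"
  by (simp add: frag_inv_def frag_eval_extend case_prod_unfold)

abbreviation act_frag :: "('a \<times> 'a \<Rightarrow>\<^sub>0 int) \<Rightarrow> 'a \<Rightarrow> 'a" where
  "act_frag x v \<equiv> frag_eval (\<lambda>(a, b). a * v * \<sigma> b) x"

lemma vtensor_ker_iff_act_frag: "x \<in> vtensor_ker s s \<longleftrightarrow> (\<forall>v. act_frag x v = 0)"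
proof
  show "x \<in> vtensor_ker s s \<Longrightarrow> \<forall>v. act_frag x v = 0"
    using balanced_vanish balanced_twisted_sandwich by blast
  assume "\<forall>v. act_frag x v = 0"
  then have twist: "frag_extend (\<lambda>(a, b). frag_of (a, \<sigma> b)) x \<in> vtensor_ker s s"
    by (simp add: vtensor_ker_iff frag_eval_extend case_prod_unfold)
  show "x \<in> vtensor_ker s s"
    using balanced_vanish[OF balanced_twisted_sandwich twist]
    by (simp add: vtensor_ker_iff frag_eval_extend case_prod_unfold)
qed

lemma act_frag_add: "act_frag x (v + w) = act_frag x v + act_frag x w"
  by (simp add: frag_eval_distrib[symmetric] case_prod_unfold algebra_simps)

lemma act_frag_mult: "act_frag (frag_mult x y) v = act_frag x (act_frag y v)"
  by (simp add: frag_eval_mult case_prod_unfold \<sigma>_mult frag_eval_mult_left[symmetric]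
      frag_eval_mult_right[symmetric] mult.assoc)

lemma frag_mult_ker:
  shows "x \<in> vtensor_ker s s \<Longrightarrow> frag_mult x y \<in> vtensor_ker s s"
    and "y \<in> vtensor_ker s s \<Longrightarrow> frag_mult x y \<in> vtensor_ker s s"
  using act_frag_add[where v = 0 and w = 0]
  by (simp_all add: vtensor_ker_iff_act_frag act_frag_mult)

lemma frag_inv_ker:
  assumes "x \<in> vtensor_ker s s"
  shows "frag_inv x \<in> vtensor_ker s s"
proof -
  have "balanced s (\<lambda>(a, b). \<sigma> a * v * \<sigma> b)" for v
    by (simp add: balanced_def algebra_simps scale_mult \<sigma>_add \<sigma>_scale)
  from balanced_vanish[OF this assms] show ?thesis
    by (simp add: vtensor_ker_iff frag_eval_inv)
qed

abbreviation tclass :: "('a \<times> 'a \<Rightarrow>\<^sub>0 int) \<Rightarrow> ('a \<times> 'a \<Rightarrow>\<^sub>0 int) set" where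
  "tclass x \<equiv> x +o vtensor_ker s s"

abbreviation "TT \<equiv> vtensor s s"

abbreviation tmult (infixl "\<odot>\<^sub>T" 70) where "U \<odot>\<^sub>T V \<equiv> aa_mult s U V"

abbreviation act where "act U v \<equiv> twisted_action \<sigma> U v"

lemma tclass_mem [simp]: "tclass x \<in> TT"
  unfolding vtensor_eq_range by blast

lemma tclass_cases: "U \<in> TT \<Longrightarrow> (\<And>x. U = tclass x \<Longrightarrow> P) \<Longrightarrow> P"
  unfolding vtensor_eq_range by blast

lemma aa_mult_tclass: "tclass x \<odot>\<^sub>T tclass y = tclass (frag_mult x y)"
  unfolding aa_mult_def frag_mult_def[symmetric]
  by (rule UN_coset2[OF vtensor_ker.add_subgroup_axioms vtensor_ker.add_subgroup_axioms
        vtensor_ker.add_subgroup_axioms])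
    (simp_all add: frag_mult_add_left frag_mult_add_right frag_mult_ker)

lemma aa_inv_tclass: "aa_inv s \<sigma> (tclass x) = tclass (frag_inv x)"
  unfolding aa_inv_def frag_inv_def[symmetric]
  by (rule UN_coset[OF vtensor_ker.add_subgroup_axioms vtensor_ker.add_subgroup_axioms])
    (simp_all add: frag_inv_ker, simp add: frag_inv_def frag_extend_add)

lemma act_tclass: "act (tclass x) v = act_frag x v"
  unfolding twisted_action_def by (rule tensor_lift_balanced[OF balanced_twisted_sandwich])

lemma vtensor_closed [simp]:
  shows "U \<in> TT \<Longrightarrow> V \<in> TT \<Longrightarrow> U \<odot>\<^sub>T V \<in> TT"
    and "U \<in> TT \<Longrightarrow> V \<in> TT \<Longrightarrow> U + V \<in> TT"
    and "U \<in> TT \<Longrightarrow> uminus ` U \<in> TT"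
    and "U \<in> TT \<Longrightarrow> aa_inv s \<sigma> U \<in> TT"
    and "aa_one s \<in> TT"
    and "vtensor_ker s s \<in> TT"
  using tclass_mem[of 0]
  by (auto elim!: tclass_cases
      simp: aa_mult_tclass aa_inv_tclass vtensor_ker.coset_plus vtensor_ker.coset_uminus aa_one_def)

lemma act_eqI:
  assumes "U \<in> TT" "V \<in> TT" and eq: "\<And>v. act U v = act V v"
  shows "U = V"
proof -
  obtain x y where xy: "U = tclass x" "V = tclass y" using assms(1,2) by (metis tclass_cases)
  have "act_frag (x - y) v = 0" for v using eq[of v] by (simp add: xy act_tclass frag_eval_diff)
  then have "x - y \<in> vtensor_ker s s" unfolding vtensor_ker_iff_act_frag by blast
  then show ?thesis by (simp only: xy vtensor_ker.coset_eq_iff)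
qed

lemma act_simps [simp]:
  shows act_add_left: "U \<in> TT \<Longrightarrow> V \<in> TT \<Longrightarrow> act (U + V) v = act U v + act V v"
    and act_uminus_left: "U \<in> TT \<Longrightarrow> act (uminus ` U) v = - act U v"
    and act_mult: "U \<in> TT \<Longrightarrow> V \<in> TT \<Longrightarrow> act (U \<odot>\<^sub>T V) v = act U (act V v)"
    and act_one: "act (aa_one s) v = v"
    and act_zero: "act (vtensor_ker s s) v = 0"
  using act_tclass[of 0 v] frag_eval_diff[of _ 0]
  by (auto elim!: tclass_cases
      simp: vtensor_ker.coset_plus vtensor_ker.coset_uminus aa_mult_tclass act_tclass
      frag_eval_add act_frag_mult aa_one_def)

lemma act_add_right: "U \<in> TT \<Longrightarrow> act U (v + w) = act U v + act U w"
  by (auto elim!: tclass_cases simp: act_tclass act_frag_add)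

lemma act_scale: "U \<in> TT \<Longrightarrow> act U (s k v) = s k (act U v)"
  by (auto elim!: tclass_cases simp: act_tclass frag_eval_additive[of "s k"] additive_def
      scale_right_distrib scale_mult case_prod_unfold)

lemma tmult_assoc: "U \<in> TT \<Longrightarrow> V \<in> TT \<Longrightarrow> W \<in> TT \<Longrightarrow> U \<odot>\<^sub>T V \<odot>\<^sub>T W = U \<odot>\<^sub>T (V \<odot>\<^sub>T W)"
  by (rule act_eqI) simp_all

lemma tmult_distrib: "U \<in> TT \<Longrightarrow> V \<in> TT \<Longrightarrow> W \<in> TT \<Longrightarrow> U \<odot>\<^sub>T (V + W) = U \<odot>\<^sub>T V + U \<odot>\<^sub>T W"
  by (rule act_eqI) (simp_all add: act_add_right)

lemma tmult_one: "U \<in> TT \<Longrightarrow> U \<odot>\<^sub>T aa_one s = U"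
  by (rule act_eqI) simp_all

end


section \<open>The trace form and the Goldman element\<close>

context swap_tensor
begin

abbreviation "T \<equiv> trace_form s \<sigma>"

lemma additive_Trd: "additive (Trd s)"
  by (simp add: additive_def Trd_add)

lemma T_add: "T (u + v) w = T u w + T v w" "T w (u + v) = T w u + T w v"
  by (simp_all add: trace_form_def \<sigma>_add algebra_simps Trd_add)

lemma T_scale: "T (s k v) w = k * T v w" "T v (s k w) = k * T v w"
  by (simp_all add: trace_form_def \<sigma>_scale scale_mult Trd_scale)

lemma T_diff: "T (u - v) w = T u w - T v w" "T w (u - v) = T w u - T w v"
  using T_add(1)[of "u - v" v w] T_add(2)[of w "u - v" v] by simp_all

lemma T_sym: "T v w = T w v"
  unfolding trace_form_def using Trd_\<sigma>[of "\<sigma> v * w"] by (simp add: \<sigma>_mult)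

lemma T_\<sigma>_left: "T (\<sigma> v) w = T v (\<sigma> w)"
  unfolding trace_form_def using Trd_\<sigma>[of "\<sigma> v * \<sigma> w"] by (simp add: \<sigma>_mult Trd_cyclic[of w])

lemma T_nondegenerate:
  assumes "\<And>w. T v w = 0"
  shows "v = 0"
proof -
  have "\<tau> (a i * \<sigma> v) = 0" for i
    using assms[of "a i"] by (simp add: \<tau>_eq_0_iff trace_form_def Trd_cyclic[of "a i"])
  then have "\<sigma> v = 0" using \<tau>_dual[of "\<sigma> v"] by simp
  then show ?thesis using \<sigma>_\<sigma>[of v] by (simp add: additive.zero[OF additive_\<sigma>])
qed

lemma T_act_aa_inv:
  assumes "U \<in> TT"
  shows "T v (act (aa_inv s \<sigma> U) w) = T (act U v) w"
proof -
  obtain x where x: "U = tclass x" using assms by (rule tclass_cases)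
  have "T v (act (aa_inv s \<sigma> U) w) = frag_eval (\<lambda>(a, b). Trd s (\<sigma> v * (\<sigma> a * w * b))) x"
    by (simp add: trace_form_def x aa_inv_tclass act_tclass frag_eval_inv
        frag_eval_mult_left[symmetric] frag_eval_additive[OF additive_Trd] case_prod_unfold)
  also have "\<dots> = frag_eval (\<lambda>(a, b). Trd s (\<sigma> (a * v * \<sigma> b) * w)) x"
  proof (rule frag_eval_cong, clarify)
    fix a b
    show "Trd s (\<sigma> v * (\<sigma> a * w * b)) = Trd s (\<sigma> (a * v * \<sigma> b) * w)"
      using Trd_cyclic[of "\<sigma> v * \<sigma> a * w" b] by (simp add: \<sigma>_mult mult.assoc)
  qed
  also have "\<dots> = T (act U v) w"
    by (simp add: trace_form_def x act_tclass frag_eval_additive[OF additive_\<sigma>]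
        frag_eval_mult_right[symmetric] frag_eval_additive[OF additive_Trd] case_prod_unfold)
  finally show ?thesis .
qed

lemma aa_inv_eqI:
  assumes "U \<in> TT" "V \<in> TT" and adjoint: "\<And>v w. T (act U v) w = T v (act V w)"
  shows "aa_inv s \<sigma> U = V"
proof (rule act_eqI)
  fix w
  have "T (act (aa_inv s \<sigma> U) w - act V w) v = 0" for v
    by (subst T_sym) (simp add: T_diff T_act_aa_inv[OF assms(1)] adjoint)
  then have "act (aa_inv s \<sigma> U) w - act V w = 0" by (rule T_nondegenerate)
  then show "act (aa_inv s \<sigma> U) w = act V w" by simp
qed (simp_all add: assms)

lemma aa_inv_mult: "U \<in> TT \<Longrightarrow> V \<in> TT \<Longrightarrow> aa_inv s \<sigma> (U \<odot>\<^sub>T V) = aa_inv s \<sigma> V \<odot>\<^sub>T aa_inv s \<sigma> U"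
  by (rule aa_inv_eqI) (simp_all add: T_act_aa_inv)

end

locale swap_tensor_char_ne_2 = swap_tensor s \<sigma> N a b
  for s :: "'k::field \<Rightarrow> 'a::ring_1 \<Rightarrow> 'a" and \<sigma> N a b +
  assumes char_ne_2: "CHAR('k) \<noteq> 2"
begin

lemma two_nonzero: "(2 :: 'k) \<noteq> 0"
proof
  assume "(2 :: 'k) = 0"
  then have "of_nat 2 = (0 :: 'k)" by simp
  then have "CHAR('k) dvd 2" by (simp only: of_nat_eq_0_iff_char_dvd)
  then have "CHAR('k) = 1" using two_is_prime_nat char_ne_2 by (auto simp: prime_nat_iff)
  then show False using CHAR_not_1' by simp
qed

lemmas sign_cases = involution_sign_cases[OF two_nonzero]

lemma sign_simps [simp]:
  "of_int \<epsilon> * (of_int \<epsilon> * x) = x" "\<sigma> (of_int \<epsilon> * x) = of_int \<epsilon> * \<sigma> x"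
  "of_int \<epsilon> * s k x = s k (of_int \<epsilon> * x)"
  using sign_cases by (auto simp: additive.minus[OF additive_\<sigma>])

lemma T_sign: "T (of_int \<epsilon> * v) w = of_int \<epsilon> * T v w" "T v (of_int \<epsilon> * w) = of_int \<epsilon> * T v w"
  using sign_cases T_scale(1)[of "- 1" v w] T_scale(2)[of v "- 1" w] by auto

lemma Trd_eq_\<tau>: "Trd s x = of_int \<epsilon> * \<tau> x"
proof -
  obtain n \<phi> where \<phi>: "irrep s n \<phi>" using irrep_exists by blast
  have "swap_coefficient n \<phi> (of_int \<epsilon>)" by (rule involution_sign_coefficient[OF two_nonzero \<phi>])
  then have "to_ac (\<tau> x) = to_ac (of_int \<epsilon> * Trd s x)"
    by (simp add: swap_coefficient_trace[OF \<phi>] to_ac_Trd[OF \<phi>])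
  then have "\<tau> x = of_int \<epsilon> * Trd s x" by (simp only: to_ac_eq_iff)
  then show ?thesis using sign_cases by auto
qed

lemma goldman_eq: "goldman s = tclass (\<Sum>i<N. frag_of (of_int \<epsilon> * a i, b i))" (is "_ = tclass ?g")
  unfolding goldman_def
proof (rule the_equality)
  have sandwich: "sandwich_frag ?g x = s (Trd s x) 1" for x
  proof -
    have "sandwich_frag ?g x = of_int \<epsilon> * (\<Sum>i<N. a i * x * b i)"
      by (simp add: frag_eval_of_sum sum_distrib_left mult.assoc)
    then show ?thesis using sign_cases by (auto simp: sandwich_eq_\<tau> Trd_eq_\<tau>)
  qed
  show "tclass ?g \<in> TT \<and> (\<forall>x. sandwich (tclass ?g) x = s (Trd s x) 1)"
    by (simp add: sandwich_coset sandwich)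
  fix z assume z: "z \<in> TT \<and> (\<forall>x. sandwich z x = s (Trd s x) 1)"
  then obtain f where f: "z = tclass f" by (metis tclass_cases)
  have "\<forall>x. sandwich_frag (f - ?g) x = 0"
    using z unfolding f sandwich_coset frag_eval_diff sandwich by simp
  then show "z = tclass ?g" unfolding f vtensor_ker.coset_eq_iff vtensor_ker_iff .
qed

lemma goldman_mem [simp]: "goldman s \<in> TT"
  by (simp add: goldman_eq)

lemma act_goldman [simp]: "act (goldman s) v = of_int \<epsilon> * \<sigma> v"
  by (simp add: goldman_eq act_tclass frag_eval_of_sum mult.assoc sum_distrib_left[symmetric])
    (simp add: mult.assoc[symmetric] twisted_sandwich)

definition alt :: "'a \<Rightarrow> 'a" where
  "alt v = v - of_int \<epsilon> * \<sigma> v"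

lemma alt_zero [simp]: "alt 0 = 0"
  by (simp add: alt_def additive.zero[OF additive_\<sigma>])

lemma alt_add: "alt (v + w) = alt v + alt w"
  by (simp add: alt_def \<sigma>_add algebra_simps)

lemma alt_scale: "alt (s k v) = s k (alt v)"
  by (simp add: alt_def \<sigma>_scale scale_right_diff_distrib)

lemma \<sigma>_alt: "\<sigma> (alt v) = - (of_int \<epsilon> * alt v)"
  by (simp add: alt_def additive.diff[OF additive_\<sigma>] right_diff_distrib)

lemma T_alt_left: "T (alt v) w = T v (alt w)"
  by (simp add: alt_def T_diff T_sign T_\<sigma>_left)

lemma T_alt_alt: "T (alt v) (alt w) = 2 * T (alt v) w"
proof -
  have "alt (alt v) = alt v + alt v"
    by (subst (1) alt_def) (simp add: \<sigma>_alt)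
  then show ?thesis by (simp add: T_alt_left[of "alt v" w, symmetric] T_add)
qed

lemma s2_mem [simp]: "s2 s \<in> TT"
  by (simp add: s2_def)

lemma act_s2 [simp]: "act (s2 s) v = alt v"
  by (simp add: s2_def alt_def)

lemma aa_inv_s2: "aa_inv s \<sigma> (s2 s) = s2 s"
  by (rule aa_inv_eqI) (simp_all add: T_alt_left)

lemma s2_mult_one_plus_goldman: "s2 s \<odot>\<^sub>T (aa_one s + goldman s) = vtensor_ker s s"
  by (rule act_eqI) (simp_all add: alt_def \<sigma>_add distrib_left)

lemma Alt2_subset: "U \<in> Alt2 s \<Longrightarrow> U \<in> TT"
  by (auto simp: Alt2_def)

lemma Alt2_closed:
  shows "U \<in> Alt2 s \<Longrightarrow> V \<in> Alt2 s \<Longrightarrow> U + V \<in> Alt2 s"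
    and "U \<in> Alt2 s \<Longrightarrow> V \<in> TT \<Longrightarrow> U \<odot>\<^sub>T V \<in> Alt2 s"
    and "s2 s \<in> Alt2 s"
    and "vtensor_ker s s \<in> Alt2 s"
proof -
  show "U \<in> Alt2 s \<Longrightarrow> V \<in> Alt2 s \<Longrightarrow> U + V \<in> Alt2 s"
    unfolding Alt2_def by (auto simp: tmult_distrib[symmetric])
  show "U \<in> Alt2 s \<Longrightarrow> V \<in> TT \<Longrightarrow> U \<odot>\<^sub>T V \<in> Alt2 s"
    unfolding Alt2_def by (auto simp: tmult_assoc)
  show "s2 s \<in> Alt2 s"
    unfolding Alt2_def by (rule image_eqI[of _ _ "aa_one s"]) (simp_all add: tmult_one)
  show "vtensor_ker s s \<in> Alt2 s"
    unfolding Alt2_def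
    by (rule image_eqI[of _ _ "aa_one s + goldman s"]) (simp_all add: s2_mult_one_plus_goldman)
qed

lemma Alt2_form_s2_mult:
  assumes "x \<in> TT" "U \<in> Alt2 s"
  shows "Alt2_form s \<sigma> (s2 s \<odot>\<^sub>T x) U = aa_inv s \<sigma> x \<odot>\<^sub>T U"
proof -
  have shift: "aa_inv s \<sigma> (s2 s \<odot>\<^sub>T x) \<odot>\<^sub>T y = aa_inv s \<sigma> x \<odot>\<^sub>T (s2 s \<odot>\<^sub>T y)" if "y \<in> TT" for y
    using assms(1) that by (simp add: aa_inv_mult aa_inv_s2 tmult_assoc)
  show ?thesis
    unfolding Alt2_form_def
  proof (rule the_equality)
    obtain y where y: "y \<in> TT" "U = s2 s \<odot>\<^sub>T y" using assms(2) unfolding Alt2_def by blast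
    then show "\<exists>y\<in>TT. U = s2 s \<odot>\<^sub>T y \<and> aa_inv s \<sigma> x \<odot>\<^sub>T U = aa_inv s \<sigma> (s2 s \<odot>\<^sub>T x) \<odot>\<^sub>T y"
      using shift by metis
  next
    fix z assume "\<exists>y\<in>TT. U = s2 s \<odot>\<^sub>T y \<and> z = aa_inv s \<sigma> (s2 s \<odot>\<^sub>T x) \<odot>\<^sub>T y"
    then show "z = aa_inv s \<sigma> x \<odot>\<^sub>T U" using shift by metis
  qed
qed

lemma T_Alt2_form:
  assumes "x \<in> TT" "U \<in> Alt2 s"
  shows "T v (act (Alt2_form s \<sigma> (s2 s \<odot>\<^sub>T x) U) w) = T (act x v) (act U w)"
  using assms Alt2_subset[OF assms(2)] by (simp add: Alt2_form_s2_mult T_act_aa_inv)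

end


section \<open>Spaces presented as quotients\<close>

text \<open>
  Both spaces of the theorem are images of \<open>A\<close> under linear maps \<open>q\<close> with the same kernel; it
  suffices to compare the forms \<open>f\<close> pulled back to \<open>A\<close>.
\<close>

definition presents ::
  "('k::field \<Rightarrow> 'a::ab_group_add \<Rightarrow> 'a) \<Rightarrow> ('a \<Rightarrow> 'a \<Rightarrow> 'k) \<Rightarrow> ('a \<Rightarrow> 'v) \<Rightarrow>
    ('k, 'v) bilinear_space \<Rightarrow> bool" where
  "presents s f q V \<longleftrightarrow> carrier V = range q \<and> (\<forall>v w. q v \<oplus>\<^bsub>V\<^esub> q w = q (v + w)) \<and> \<zero>\<^bsub>V\<^esub> = q 0 \<and>
    (\<forall>k v. k \<odot>\<^bsub>V\<^esub> q v = q (s k v)) \<and> (\<forall>v w. form V (q v) (q w) = f v w)"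

lemma presentsD:
  assumes "presents s f q V"
  shows "carrier V = range q" "q v \<oplus>\<^bsub>V\<^esub> q w = q (v + w)" "\<zero>\<^bsub>V\<^esub> = q 0"
    "k \<odot>\<^bsub>V\<^esub> q v = q (s k v)" "form V (q v) (q w) = f v w"
  using assms by (auto simp: presents_def)

lemma presents_isometric:
  assumes V: "presents s f q V" and W: "presents s f q' W"
    and kernels: "\<And>v w. q v = q w \<longleftrightarrow> q' v = q' w"
  shows "isometric V W"
proof -
  define g where "g x = q' (SOME v. q v = x)" for x
  have g: "g (q v) = q' v" for v
  proof -
    have "q (SOME w. q w = q v) = q v" by (rule someI[of _ v]) simp
    then show ?thesis unfolding g_def using kernels by blast
  qed
  have "bij_betw g (carrier V) (carrier W)"
    using V W kernels by (auto simp: presents_def bij_betw_def inj_on_def g image_image)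
  then show ?thesis
    unfolding isometric_def using V W by (intro exI[of _ g]) (auto simp: presents_def g)
qed

context vector_space
begin

lemma presents_module:
  assumes "presents scale f q V"
  shows "Module.module (ring_of_type_algebra :: 'a ring) V"
proof -
  note presented = presentsD[OF assms]
  have "abelian_group V"
  proof (rule abelian_groupI)
    fix x assume "x \<in> carrier V"
    then obtain v where x: "x = q v" by (auto simp: presented)
    have "q (- v) \<oplus>\<^bsub>V\<^esub> x = \<zero>\<^bsub>V\<^esub>" by (simp add: x presented)
    then show "\<exists>y\<in>carrier V. y \<oplus>\<^bsub>V\<^esub> x = \<zero>\<^bsub>V\<^esub>" by (auto simp: presented)
  qed (auto simp: presented add_ac)
  then show ?thesis
    by (intro Module.moduleI cring_from_type_algebra)
      (auto simp: ring_of_type_algebra_def presented scale_left_distrib scale_right_distrib)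
qed

lemma presents_submodule_eq_carrier:
  assumes "presents scale f q V" and "span D = UNIV"
    and H: "submodule H (ring_of_type_algebra :: 'a ring) V" and "q ` D \<subseteq> H"
  shows "H = carrier V"
proof
  interpret H: submodule H "ring_of_type_algebra :: 'a ring" V by (rule H)
  show "H \<subseteq> carrier V" using H.subset by simp
  note presented = presentsD[OF assms(1)]
  have "subspace {v. q v \<in> H}"
  proof (rule subspaceI)
    show "0 \<in> {v. q v \<in> H}" using H.one_closed by (simp add: presented)
    show "u + v \<in> {v. q v \<in> H}" if "u \<in> {v. q v \<in> H}" "v \<in> {v. q v \<in> H}" for u v
      using H.m_closed[of "q u" "q v"] that by (simp add: presented)
    show "scale k v \<in> {v. q v \<in> H}" if "v \<in> {v. q v \<in> H}" for k v
      using H.smult_closed[of k "q v"] that by (simp add: presented ring_of_type_algebra_def)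
  qed
  moreover have "D \<subseteq> {v. q v \<in> H}" using assms(4) by auto
  ultimately have "span D \<subseteq> {v. q v \<in> H}" by (intro span_minimal)
  then show "carrier V \<subseteq> H" using assms(2) by (auto simp: presented)
qed

lemma presents_nondeg_symmetric_space:
  assumes V: "presents scale f q V" and D: "finite D" "span D = UNIV"
    and f_add: "\<And>u v w. f (u + v) w = f u w + f v w"
    and f_scale: "\<And>k v w. f (scale k v) w = k * f v w"
    and f_sym: "\<And>v w. f v w = f w v"
    and f_radical: "\<And>v. (\<And>w. f v w = 0) \<Longrightarrow> q v = q 0"
  shows "nondeg_symmetric_space V"
proof -
  note presented = presentsD[OF V]
  have "\<exists>B. finite B \<and> B \<subseteq> carrier V \<and>
      (\<forall>H. submodule H (ring_of_type_algebra :: 'a ring) V \<and> B \<subseteq> H \<longrightarrow> H = carrier V)"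
    using presents_submodule_eq_carrier[OF V D(2)] D(1) presented(1)
    by (intro exI[of _ "q ` D"]) (simp add: image_mono)
  moreover have "\<forall>x\<in>carrier V. (\<forall>y\<in>carrier V. form V x y = 0) \<longrightarrow> x = \<zero>\<^bsub>V\<^esub>"
    using f_radical by (auto simp: presented)
  moreover have "\<forall>x\<in>carrier V. \<forall>y\<in>carrier V. form V x y = form V y x"
    by (auto simp: presented intro: f_sym)
  moreover have "\<forall>x\<in>carrier V. \<forall>y\<in>carrier V. \<forall>z\<in>carrier V.
      form V (x \<oplus>\<^bsub>V\<^esub> y) z = form V x z + form V y z"
    by (auto simp: presented f_add)
  moreover have "\<forall>k. \<forall>x\<in>carrier V. \<forall>y\<in>carrier V. form V (k \<odot>\<^bsub>V\<^esub> x) y = k * form V x y"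
    by (auto simp: presented f_scale)
  ultimately show ?thesis
    unfolding nondeg_symmetric_space_def by (intro conjI presents_module[OF V])
qed

end


section \<open>The exterior square\<close>

interpretation lambda2_ker: add_subgroup "lambda2_ker s \<sigma>" for s \<sigma>
  by unfold_locales (simp_all add: lambda2_ker_def tensor_ker.zero_mem tensor_ker.diff_mem)

context swap_tensor_char_ne_2
begin

lemma trace_form_part_presented:
  "presents s (\<lambda>v w. T (alt v) w) (\<lambda>v. s (1 / 2) (alt v))
    (scale_form 2 (trace_form_part s \<sigma> (- \<epsilon>)))"
proof -
  have "{x. \<sigma> x = of_int (- \<epsilon>) * x} = range (\<lambda>v. s (1 / 2) (alt v))"
  proof
    show "range (\<lambda>v. s (1 / 2) (alt v)) \<subseteq> {x. \<sigma> x = of_int (- \<epsilon>) * x}"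
      by (auto simp: \<sigma>_scale \<sigma>_alt)
    show "{x. \<sigma> x = of_int (- \<epsilon>) * x} \<subseteq> range (\<lambda>v. s (1 / 2) (alt v))"
    proof
      fix x assume "x \<in> {x. \<sigma> x = of_int (- \<epsilon>) * x}"
      then have "alt x = s 1 x + s 1 x" by (simp add: alt_def)
      also have "\<dots> = s 2 x" by (simp only: scale_left_distrib[symmetric] one_add_one)
      finally have "x = s (1 / 2) (alt x)" using two_nonzero by simp
      then show "x \<in> range (\<lambda>v. s (1 / 2) (alt v))" by blast
    qed
  qed
  moreover have "2 * T (s (1 / 2) (alt v)) (s (1 / 2) (alt w)) = T (alt v) w" for v w
    using two_nonzero by (simp only: T_scale T_alt_alt) simp
  ultimately show ?thesis
    by (simp add: presents_def scale_form_def trace_form_part_def alt_add alt_scale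
        scale_right_distrib[symmetric] scale_left_commute)
qed

abbreviation "ker2 \<equiv> lambda2_ker s \<sigma>"

abbreviation "s2_tensor v \<equiv> frag_of (s2 s, v) +o ker2"

lemma ker2_rules:
  shows ker2_add_left: "U \<in> Alt2 s \<Longrightarrow> U' \<in> Alt2 s \<Longrightarrow>
      frag_of (U + U', v) - frag_of (U, v) - frag_of (U', v) \<in> ker2"
    and ker2_add_right: "U \<in> Alt2 s \<Longrightarrow>
      frag_of (U, v + v') - frag_of (U, v) - frag_of (U, v') \<in> ker2"
    and ker2_balanced: "U \<in> Alt2 s \<Longrightarrow> V \<in> TT \<Longrightarrow>
      frag_of (U \<odot>\<^sub>T V, v) - frag_of (U, act V v) \<in> ker2"
  unfolding lambda2_ker_def by (rule tensor_ker_rules; simp)+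

lemma ker2_vanish:
  assumes "f \<in> ker2"
    and "\<And>U U' v. U \<in> Alt2 s \<Longrightarrow> U' \<in> Alt2 s \<Longrightarrow> h (U + U', v) = h (U, v) + h (U', v)"
    and "\<And>U v v'. U \<in> Alt2 s \<Longrightarrow> h (U, v + v') = h (U, v) + h (U, v')"
    and "\<And>U V v. U \<in> Alt2 s \<Longrightarrow> V \<in> TT \<Longrightarrow> h (U \<odot>\<^sub>T V, v) = h (U, act V v)"
  shows "frag_eval h f = 0"
  using assms(1) unfolding lambda2_ker_def by (rule tensor_ker_vanish) (auto intro: assms)

lemma s2_tensor_add: "s2_tensor v + s2_tensor w = s2_tensor (v + w)"
  using lambda2_ker.uminus_mem[OF ker2_add_right[OF Alt2_closed(3), of v w]]
  by (simp add: lambda2_ker.coset_plus lambda2_ker.coset_eq_iff algebra_simps)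

text \<open>\<open>s\<^sub>2 y \<otimes> v = s\<^sub>2 \<otimes> y v\<close>.\<close>

lemma s2_tensor_representative:
  assumes "Poly_Mapping.keys f \<subseteq> Alt2 s \<times> UNIV"
  shows "\<exists>v. f +o ker2 = s2_tensor v"
  using assms
proof (induction f rule: frag_induction)
  case zero
  have "0 - frag_of (s2 s, 0) \<in> ker2"
    using ker2_add_right[OF Alt2_closed(3), of 0 0] by simp
  then show ?case unfolding lambda2_ker.coset_eq_iff by blast
next
  case (one p)
  then obtain y v where "p = (s2 s \<odot>\<^sub>T y, v)" "y \<in> TT" unfolding Alt2_def by auto
  then show ?case
    unfolding lambda2_ker.coset_eq_iff using ker2_balanced[OF Alt2_closed(3), of y v] by blast
next
  case (diff f g)
  then obtain v w where v: "f - frag_of (s2 s, v) \<in> ker2" and w: "g - frag_of (s2 s, w) \<in> ker2"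
    unfolding lambda2_ker.coset_eq_iff by blast
  have "(f - frag_of (s2 s, v)) - (g - frag_of (s2 s, w)) +
      (frag_of (s2 s, (v - w) + w) - frag_of (s2 s, v - w) - frag_of (s2 s, w)) \<in> ker2"
    by (rule lambda2_ker.add_mem[OF lambda2_ker.diff_mem[OF v w] ker2_add_right[OF Alt2_closed(3)]])
  then have "f - g - frag_of (s2 s, v - w) \<in> ker2" by (simp add: algebra_simps)
  then show ?case unfolding lambda2_ker.coset_eq_iff by blast
qed

text \<open>If \<open>v = \<epsilon> \<sigma>(v)\<close>, then \<open>v = (1 + g) (v / 2)\<close>, and \<open>s\<^sub>2 (1 + g) = 0\<close>.\<close>

lemma alt_eq_0_imp_ker2:
  assumes "alt v = 0"
  shows "frag_of (s2 s, v) \<in> ker2"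
proof -
  let ?r = "aa_one s + goldman s" and ?v = "s (1 / 2) v"
  have "v = of_int \<epsilon> * \<sigma> v" using assms by (simp add: alt_def)
  then have "act ?r ?v = s (1 / 2) v + s (1 / 2) v" by (simp add: \<sigma>_scale)
  also have "\<dots> = v" using two_nonzero by (simp add: scale_left_distrib[symmetric])
  finally have "act ?r ?v = v" .
  then have "frag_of (vtensor_ker s s, ?v) - frag_of (s2 s, v) \<in> ker2"
    using ker2_balanced[OF Alt2_closed(3), of ?r ?v] by (simp add: s2_mult_one_plus_goldman)
  moreover have "frag_of (vtensor_ker s s, ?v) \<in> ker2"
  proof -
    have "vtensor_ker s s + vtensor_ker s s = vtensor_ker s s"
      using vtensor_ker.coset_plus[of 0 s s 0] by simp
    then show ?thesis
      using lambda2_ker.uminus_mem[OF ker2_add_left[OF Alt2_closed(4) Alt2_closed(4), of ?v]]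
      by simp
  qed
  ultimately show ?thesis using lambda2_ker.diff_mem by fastforce
qed

lemma s2_tensor_eq_iff: "s2_tensor v = s2_tensor w \<longleftrightarrow> alt v = alt w"
proof
  assume "s2_tensor v = s2_tensor w"
  then have "frag_of (s2 s, v) - frag_of (s2 s, w) \<in> ker2" by (simp add: lambda2_ker.coset_eq_iff)
  then have "frag_eval (\<lambda>(U, v). act U v) (frag_of (s2 s, v) - frag_of (s2 s, w)) = 0"
    by (rule ker2_vanish) (simp_all add: act_add_right Alt2_subset)
  then show "alt v = alt w" by (simp add: frag_eval_diff)
next
  assume "alt v = alt w"
  then have "alt (v - w) = 0" using alt_add[of "v - w" w] by simp
  then have "frag_of (s2 s, (v - w) + w) - frag_of (s2 s, v - w) - frag_of (s2 s, w) +
      frag_of (s2 s, v - w) \<in> ker2"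
    by (intro lambda2_ker.add_mem ker2_add_right Alt2_closed(3) alt_eq_0_imp_ker2)
  then show "s2_tensor v = s2_tensor w" by (simp add: lambda2_ker.coset_eq_iff)
qed

lemma lambda2_carrier: "carrier (lambda2 s \<sigma>) = range (\<lambda>v. s2_tensor v)"
proof
  have carrier: "carrier (lambda2 s \<sigma>) = {f +o ker2 |f. Poly_Mapping.keys f \<subseteq> Alt2 s \<times> UNIV}"
    by (simp add: lambda2_def tensor_carrier_def lambda2_ker_def)
  show "carrier (lambda2 s \<sigma>) \<subseteq> range (\<lambda>v. s2_tensor v)"
    unfolding carrier using s2_tensor_representative by blast
  show "range (\<lambda>v. s2_tensor v) \<subseteq> carrier (lambda2 s \<sigma>)"
  proof
    fix z assume "z \<in> range (\<lambda>v. s2_tensor v)"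
    then obtain v where "z = s2_tensor v" by blast
    moreover have "Poly_Mapping.keys (frag_of (s2 s, v)) \<subseteq> Alt2 s \<times> UNIV"
      using Alt2_closed(3) by simp
    ultimately show "z \<in> carrier (lambda2 s \<sigma>)" unfolding carrier by blast
  qed
qed

lemma lambda2_smult: "k \<odot>\<^bsub>lambda2 s \<sigma>\<^esub> s2_tensor v = s2_tensor (s k v)"
proof -
  define scale_frag where
    "scale_frag x = frag_extend (\<lambda>(U :: ('a \<times> 'a \<Rightarrow>\<^sub>0 int) set, v). frag_of (U, s k v)) x" for x
  have "scale_frag x \<in> ker2" if "x \<in> ker2" for x
    using that unfolding lambda2_ker_def
  proof (induction rule: tensor_ker_induct)
    case (balanced U V v)
    then show ?case
      using ker2_balanced[of U V "s k v"]
      by (simp add: scale_frag_def frag_extend_diff act_scale lambda2_ker_def)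
  qed (simp_all add: scale_frag_def frag_extend_diff scale_right_distrib tensor_ker_rules
      tensor_ker.zero_mem tensor_ker.diff_mem)
  then have "(\<Union>x\<in>s2_tensor v. scale_frag x +o ker2) = scale_frag (frag_of (s2 s, v)) +o ker2"
    by (intro UN_coset lambda2_ker.add_subgroup_axioms)
      (simp_all add: scale_frag_def frag_extend_add)
  then show ?thesis by (simp add: lambda2_def scale_frag_def)
qed

lemma lambda2_inner_form:
  assumes "U \<in> Alt2 s"
  shows "tensor_lift (\<lambda>(U', v'). T v (act (Alt2_form s \<sigma> U U') v')) (s2_tensor w) = T (act U v) w"
proof -
  let ?h = "\<lambda>(U', v'). T v (act (Alt2_form s \<sigma> U U') v')"
  obtain x where x: "x \<in> TT" "U = s2 s \<odot>\<^sub>T x" using assms unfolding Alt2_def by blast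
  have "tensor_lift ?h (s2_tensor w) = frag_eval ?h (frag_of (s2 s, w))"
  proof (rule tensor_lift_coset[OF lambda2_ker.add_subgroup_axioms])
    fix f assume "f \<in> ker2"
    then show "frag_eval ?h f = 0"
      by (rule ker2_vanish)
        (simp_all add: x T_Alt2_form Alt2_closed act_add_right Alt2_subset T_add)
  qed
  also have "\<dots> = T (act x v) (alt w)"
    using T_Alt2_form[OF x(1) Alt2_closed(3)] by (simp add: x(2))
  also have "\<dots> = T (act U v) w" by (simp add: x T_alt_left)
  finally show ?thesis .
qed

lemma lambda2_form: "form (lambda2 s \<sigma>) (s2_tensor v) (s2_tensor w) = T (alt v) w"
proof -
  let ?h = "\<lambda>(U, v). tensor_lift (\<lambda>(U', v'). T v (act (Alt2_form s \<sigma> U U') v')) (s2_tensor w)"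
  have "tensor_lift ?h (s2_tensor v) = frag_eval ?h (frag_of (s2 s, v))"
  proof (rule tensor_lift_coset[OF lambda2_ker.add_subgroup_axioms])
    fix f assume "f \<in> ker2"
    then show "frag_eval ?h f = 0"
      by (rule ker2_vanish)
        (simp_all add: lambda2_inner_form Alt2_closed act_add_right Alt2_subset T_add)
  qed
  also have "\<dots> = T (alt v) w" by (simp add: lambda2_inner_form Alt2_closed(3))
  finally show ?thesis by (simp add: lambda2_def)
qed

lemma lambda2_presented: "presents s (\<lambda>v w. T (alt v) w) (\<lambda>v. s2_tensor v) (lambda2 s \<sigma>)"
proof -
  have "frag_of (s2 s, 0) \<in> ker2" by (rule alt_eq_0_imp_ker2[OF alt_zero])
  then have "s2_tensor 0 = 0 +o ker2" unfolding lambda2_ker.coset_eq_iff by simp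
  then have "\<zero>\<^bsub>lambda2 s \<sigma>\<^esub> = s2_tensor 0" by (simp add: lambda2_def)
  moreover have "s2_tensor v \<oplus>\<^bsub>lambda2 s \<sigma>\<^esub> s2_tensor w = s2_tensor (v + w)" for v w
    using s2_tensor_add[of v w] by (simp add: lambda2_def)
  ultimately show ?thesis
    unfolding presents_def using lambda2_carrier lambda2_smult lambda2_form by blast
qed

lemma alt_presented_nondeg:
  assumes "presents s (\<lambda>v w. T (alt v) w) q V" and "\<And>v w. q v = q w \<longleftrightarrow> alt v = alt w"
  shows "nondeg_symmetric_space V"
proof -
  obtain D where D: "finite D" "span D = UNIV" by (rule finite_spanning_set)
  show ?thesis
  proof (rule presents_nondeg_symmetric_space[OF assms(1) D])
    show "T (alt v) w = T (alt w) v" for v w by (simp add: T_alt_left T_sym[of v])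
    show "q v = q 0" if "\<And>w. T (alt v) w = 0" for v
      using T_nondegenerate[OF that] by (simp add: assms(2))
  qed (simp_all add: alt_add alt_scale T_add T_scale)
qed

lemma lambda2_SW_eq: "SW_eq (lambda2 s \<sigma>) (scale_form 2 (trace_form_part s \<sigma> (- \<epsilon>)))"
proof -
  have half_eq_iff: "s (1 / 2) (alt v) = s (1 / 2) (alt w) \<longleftrightarrow> alt v = alt w" for v w
    using two_nonzero by simp
  have "isometric (lambda2 s \<sigma>) (scale_form 2 (trace_form_part s \<sigma> (- \<epsilon>)))"
    by (rule presents_isometric[OF lambda2_presented trace_form_part_presented])
      (simp only: s2_tensor_eq_iff half_eq_iff)
  then show ?thesis
    unfolding SW_eq_def
    using alt_presented_nondeg[OF lambda2_presented s2_tensor_eq_iff]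
      alt_presented_nondeg[OF trace_form_part_presented half_eq_iff] by blast
qed

end

theorem corollary4p15:
  fixes scale :: "'k::field \<Rightarrow> 'a::ring_1 \<Rightarrow> 'a" and \<sigma> :: "'a \<Rightarrow> 'a"
  assumes "CHAR('k) \<noteq> 2"
    and "azumaya_algebra scale"
    and "involution_first_kind scale \<sigma>"
  shows "SW_eq (lambda2 scale \<sigma>)
    (scale_form 2 (trace_form_part scale \<sigma> (- involution_sign scale \<sigma>)))"
proof -
  interpret azumaya_involution scale \<sigma>
    by unfold_locales (fact assms(2), fact assms(3))
  obtain N a b where "swap_tensor scale \<sigma> N a b" using swap_tensor_exists by blast
  then interpret swap_tensor_char_ne_2 scale \<sigma> N a b
    by (intro swap_tensor_char_ne_2.intro swap_tensor_char_ne_2_axioms.intro assms(1))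
  show ?thesis by (rule lambda2_SW_eq)
qed

end
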